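(* For $i=1,2$ let $\tilde{\boldsymbol\mu}^{(i)}\sim\mathrm{hCRV}(\rho^{(i)},\rho_0^{(i)},P_0^{(i)})$, where $\rho^{(i)},\rho_0^{(i)}$ are Lévy measures on $(0,+\infty)$ and $P_0^{(i)}$ are atomless probability measures on $\mathbb X$. Then $\tilde{\boldsymbol\mu}^{(1)}$ and $\tilde{\boldsymbol\mu}^{(2)}$ are equal in distribution if and only if there exists $c>0$ such that $$\rho_0^{(2)}=(c^{-1})_{\#}\rho_0^{(1)},\qquad \rho^{(2)}=c\,\rho^{(1)},\qquad P_0^{(1)}=P_0^{(2)},$$ where for $a>0$, $a_{\#}$ denotes pushforward under the map $s\mapsto as$. In particular, if all $\rho^{(i)},\rho_0^{(i)}$ have Lévy densities, this is equivalent to the existence of $c>0$ with $\rho_0^{(2)}(s)=c\,\rho_0^{(1)}(cs)$, $\rho^{(2)}(s)=c\,\rho^{(1)}(s)$ for all $s>0$, and $P_0^{(1)}=P_0^{(2)}$.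
   Context: Let $\mathbb X$ be a Polish space. A Lévy measure on $(0,+\infty)$ is a σ-finite measure $\rho$ with $\rho((\epsilon,+\infty))<\infty$ and $\int_{(0,\epsilon)}s\,\mathrm d\rho(s)<\infty$ for all $\epsilon>0$; its Laplace exponent is $\psi(\lambda)=\int_0^{+\infty}(1-e^{-\lambda s})\,\mathrm d\rho(s)$. For a finite (possibly random) measure $m$ on $\mathbb X$, $\tilde\mu\sim\mathrm{CRM}(\rho\otimes m)$ means that (conditionally on $m$) evaluations of $\tilde\mu$ on pairwise disjoint Borel sets are independent and $E[e^{-\lambda\tilde\mu(A)}]=e^{-m(A)\psi(\lambda)}$. $\tilde{\boldsymbol\mu}=(\tilde\mu_1,\dots,\tilde\mu_d)\sim\mathrm{hCRV}(\rho,\rho_0,P_0)$ means $\tilde\mu_0\sim\mathrm{CRM}(\rho_0\otimes P_0)$ and, conditionally on $\tilde\mu_0$, $\tilde\mu_1,\dots,\tilde\mu_d$ are independent with $\tilde\mu_i\sim\mathrm{CRM}(\rho\otimes\tilde\mu_0)$. Equality in distribution is as random elements of the space of $d$-tuples of boundedly finite measures on $\mathbb X$.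
   Formalization: Assumes d ≥ 2 and that all four Lévy measures are nonzero (the "only if" fails for d = 1, e.g. swapped stable measures, or when a Lévy measure vanishes), and the density identities are stated for Lebesgue-almost every s > 0, since densities are only determined almost everywhere. *)

theory Defs
  imports "HOL-Probability.Probability"
begin

text \<open>Levy measure on (0,+infinity), represented as a Borel measure on the reals
  giving no mass to (-infinity,0].\<close>
definition levy_measure :: "real measure \<Rightarrow> bool" where
  "levy_measure \<rho> \<longleftrightarrow> sets \<rho> = sets borel \<and> emeasure \<rho> {..0} = 0 \<and>
     sigma_finite_measure \<rho> \<and>
     (\<forall>\<epsilon>>0. emeasure \<rho> {\<epsilon><..} < \<infinity> \<and>
              (\<integral>\<^sup>+ s. ennreal s * indicator {0<..<\<epsilon>} s \<partial>\<rho>) < \<infinity>)"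

definition laplace_exp :: "real measure \<Rightarrow> real \<Rightarrow> real" where
  "laplace_exp \<rho> t = (\<integral>s. 1 - exp (- t * s) \<partial>\<rho>)"

text \<open>exp(-lambda x) for x in [0,infinity], with 0 * infinity = 0.\<close>
definition expneg :: "real \<Rightarrow> ennreal \<Rightarrow> real" where
  "expneg t x = (if x = \<infinity> then (if t = 0 then 1 else 0) else exp (- t * enn2real x))"

definition bfm :: "('x::polish_space) measure set" where
  "bfm = {m. sets m = sets borel \<and> (\<forall>A\<in>sets borel. bounded A \<longrightarrow> emeasure m A < \<infinity>)}"

definition rm1 :: "('x::polish_space) measure measure" where
  "rm1 = sigma bfm {{m \<in> bfm. emeasure m A \<in> B} | A B. A \<in> sets borel \<and> B \<in> sets (borel :: ennreal measure)}"

definition rm_space :: "nat \<Rightarrow> (nat \<Rightarrow> ('x::polish_space) measure) measure" where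
  "rm_space d = sigma {m. \<forall>i\<in>{1..d}. m i \<in> bfm}
     {{m. \<forall>i\<in>{1..d}. m i \<in> bfm} \<inter> {m. emeasure (m i) A \<in> B} | i A B.
        i \<in> {1..d} \<and> A \<in> sets borel \<and> B \<in> sets (borel :: ennreal measure)}"

definition is_CRM :: "'a measure \<Rightarrow> ('a \<Rightarrow> ('x::polish_space) measure) \<Rightarrow> real measure \<Rightarrow> 'x measure \<Rightarrow> bool" where
  "is_CRM M \<mu> \<rho> P \<longleftrightarrow> \<mu> \<in> measurable M rm1 \<and>
     (\<forall>A::nat \<Rightarrow> 'x set. disjoint_family A \<and> range A \<subseteq> sets borel \<longrightarrow>
        prob_space.indep_vars M (\<lambda>_. borel) (\<lambda>j \<omega>. emeasure (\<mu> \<omega>) (A j)) UNIV) \<and>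
     (\<forall>A\<in>sets borel. \<forall>t\<ge>0.
        (\<integral>\<omega>. expneg t (emeasure (\<mu> \<omega>) A) \<partial>M) = exp (- measure P A * laplace_exp \<rho> t))"

text \<open>Conditionally on mu0, mu_1..mu_d are independent with mu_i ~ CRM(rho (x) mu0):
  expressed via the conditional joint Laplace transform of evaluations on
  pairwise disjoint Borel sets, tested against events of sigma(mu0).\<close>
definition cond_CRMs :: "'a measure \<Rightarrow> nat \<Rightarrow> ('a \<Rightarrow> nat \<Rightarrow> ('x::polish_space) measure) \<Rightarrow>
    ('a \<Rightarrow> 'x measure) \<Rightarrow> real measure \<Rightarrow> bool" where
  "cond_CRMs M d \<mu> \<mu>0 \<rho> \<longleftrightarrow>
     (\<forall>(k::nat) (A::nat \<Rightarrow> 'x set) (lam::nat \<Rightarrow> nat \<Rightarrow> real) E.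
        disjoint_family_on A {..<k} \<and> A ` {..<k} \<subseteq> sets borel \<and> (\<forall>i j. 0 \<le> lam i j) \<and>
        E \<in> sets rm1 \<longrightarrow>
        (\<integral>\<omega>. indicator E (\<mu>0 \<omega>) *
              (\<Prod>i\<in>{1..d}. \<Prod>j<k. expneg (lam i j) (emeasure (\<mu> \<omega> i) (A j))) \<partial>M)
      = (\<integral>\<omega>. indicator E (\<mu>0 \<omega>) *
              (\<Prod>i\<in>{1..d}. \<Prod>j<k. expneg (laplace_exp \<rho> (lam i j)) (emeasure (\<mu>0 \<omega>) (A j))) \<partial>M))"

definition is_hCRV :: "'a measure \<Rightarrow> nat \<Rightarrow> ('a \<Rightarrow> nat \<Rightarrow> ('x::polish_space) measure) \<Rightarrow>
    real measure \<Rightarrow> real measure \<Rightarrow> 'x measure \<Rightarrow> bool" where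
  "is_hCRV M d \<mu> \<rho> \<rho>0 P0 \<longleftrightarrow> prob_space M \<and> \<mu> \<in> measurable M (rm_space d) \<and>
     (\<exists>\<mu>0. is_CRM M \<mu>0 \<rho>0 P0 \<and> cond_CRMs M d \<mu> \<mu>0 \<rho>)"

definition eq_dist :: "nat \<Rightarrow> 'a measure \<Rightarrow> ('a \<Rightarrow> nat \<Rightarrow> ('x::polish_space) measure) \<Rightarrow>
    'b measure \<Rightarrow> ('b \<Rightarrow> nat \<Rightarrow> 'x measure) \<Rightarrow> bool" where
  "eq_dist d M1 \<mu>1 M2 \<mu>2 \<longleftrightarrow> distr M1 (rm_space d) \<mu>1 = distr M2 (rm_space d) \<mu>2"

definition atomless_prob :: "('x::polish_space) measure \<Rightarrow> bool" where
  "atomless_prob P \<longleftrightarrow> prob_space P \<and> sets P = sets borel \<and> (\<forall>x. emeasure P {x} = 0)"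

end

theory Submission
  imports Defs "HOL-Complex_Analysis.Cauchy_Integral_Formula"
begin

text \<open>
  Let \<open>\<psi>\<close> and \<open>\<psi>0\<close> be the Laplace exponents of \<open>\<rho>\<close> and \<open>\<rho>0\<close>. Evaluations on disjoint sets \<open>A\<^sub>j\<close> have
  joint Laplace transform \<open>\<Prod>\<^sub>j exp (- P0(A\<^sub>j) \<psi>0(\<Sum>\<^sub>i \<psi>(\<lambda>\<^sub>i\<^sub>j)))\<close>. Writing overlapping sets as unions of atoms and
  using the substitution \<open>x \<mapsto> exp (-x)\<close>, which turns Laplace transforms into moments on \<open>[0, 1]\<close>,
  these transforms determine the law. Hence equality in distribution means that
  \<open>P0(A) \<psi>0(\<Sum>\<^sub>i \<psi>(\<lambda>\<^sub>i))\<close> agrees for both models.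

  Since \<open>d \<ge> 2\<close>, two coordinates give \<open>\<psi>0(\<psi>(a) + \<psi>(b))\<close> for all \<open>a\<close>, \<open>b\<close>. So the increasing map taking
  \<open>\<psi>\<close> of the first model to \<open>\<psi>\<close> of the second respects those sums that stay in the range of \<open>\<psi>\<close>. It
  solves Cauchy's functional equation on an interval and is multiplication by some \<open>c > 0\<close>. Then
  the outer exponents are related by \<open>x \<mapsto> c x\<close> on the range of \<open>\<psi>\<close> only, which may be a bounded
  interval, but a Levy measure is determined by its Laplace exponent near zero.
\<close>

section \<open>Moment determinacy on the unit interval\<close>

lemma integrable_power_unit_interval:
  fixes M :: "real measure"
  assumes M: "finite_measure M" "sets M = sets borel" "AE x in M. x \<in> {0..1}"
  shows "integrable M (\<lambda>x. x ^ n)"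
proof -
  interpret finite_measure M by fact
  have [measurable_cong]: "sets M = sets borel" by fact
  show ?thesis
    by (rule integrable_const_bound[where B=1])
       (auto intro: eventually_mono[OF M(3)] simp: power_le_one)
qed

text \<open>By the Weierstrass theorem \<open>f\<close> is uniformly close on the unit interval to a
  polynomial, and equal moments give equal integrals of polynomials. A gap \<open>D\<close> between
  the integrals of \<open>f\<close> would then be smaller than itself.\<close>

lemma integral_eq_if_moments_eq:
  fixes M N :: "real measure" and f :: "real \<Rightarrow> real"
  assumes M: "finite_measure M" "sets M = sets borel" "AE x in M. x \<in> {0..1}"
    and N: "finite_measure N" "sets N = sets borel" "AE x in N. x \<in> {0..1}"
    and moments: "\<And>n. (\<integral>x. x ^ n \<partial>M) = (\<integral>x. x ^ n \<partial>N)"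
    and f: "continuous_on UNIV f"
  shows "(\<integral>x. f x \<partial>M) = (\<integral>x. f x \<partial>N)"
proof (rule ccontr)
  assume neq: "(\<integral>x. f x \<partial>M) \<noteq> (\<integral>x. f x \<partial>N)"
  interpret M: finite_measure M by fact
  interpret N: finite_measure N by fact
  have [measurable_cong]: "sets M = sets borel" "sets N = sets borel" by fact+
  have [measurable]: "f \<in> borel_measurable borel" by (rule borel_measurable_continuous_onI[OF f])
  define D where "D = \<bar>(\<integral>x. f x \<partial>M) - (\<integral>x. f x \<partial>N)\<bar>"
  \<comment> \<open>The summand 1 makes \<open>T\<close> positive even for null measures and makes
    the total error \<open>D / T * (T - 1)\<close> strictly smaller than \<open>D\<close>.\<close>
  define T where "T = measure M (space M) + measure N (space N) + 1"
  have "D > 0" using neq by (simp add: D_def)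
  have "T > 0" by (simp add: T_def add_nonneg_pos)
  obtain p where p: "real_polynomial_function p" "\<And>x. x \<in> {0..1} \<Longrightarrow> \<bar>f x - p x\<bar> < D / T"
    using Stone_Weierstrass_real_polynomial_function[of "{0..1::real}" f "D / T"]
      continuous_on_subset[OF f] \<open>D > 0\<close> \<open>T > 0\<close> by (metis compact_Icc subset_UNIV divide_pos_pos)
  obtain a n where pa: "p = (\<lambda>x. \<Sum>i\<le>n. a i * x^i)"
    using p(1) by (auto simp: real_polynomial_function_iff_sum)
  have [measurable]: "p \<in> borel_measurable borel" unfolding pa by measurable
  have pint: "integrable M p" "integrable N p"
    unfolding pa by (auto intro!: integrable_power_unit_interval M N)
  have p_eq: "(\<integral>x. p x \<partial>M) = (\<integral>x. p x \<partial>N)"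
    unfolding pa
    by (subst (1 2) Bochner_Integration.integral_sum)
       (auto simp: moments intro!: integrable_power_unit_interval M N)
  have "bounded (f ` {0..1})"
    by (intro compact_imp_bounded compact_continuous_image continuous_on_subset[OF f]) auto
  then obtain B where B: "\<And>x. x \<in> {0..1} \<Longrightarrow> \<bar>f x\<bar> \<le> B" unfolding bounded_iff by (metis image_eqI real_norm_def)
  have "integrable M f"
    by (rule M.integrable_const_bound[where B=B]) (auto intro: eventually_mono[OF M(3)] B)
  moreover have "integrable N f"
    by (rule N.integrable_const_bound[where B=B]) (auto intro: eventually_mono[OF N(3)] B)
  ultimately have fint: "integrable M f" "integrable N f" by auto
  have bM: "\<bar>(\<integral>x. f x \<partial>M) - (\<integral>x. p x \<partial>M)\<bar> \<le> D / T * measure M (space M)"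
  proof -
    have "\<bar>\<integral>x. f x - p x \<partial>M\<bar> \<le> (\<integral>x. \<bar>f x - p x\<bar> \<partial>M)" by (rule integral_abs_bound)
    also have "\<dots> \<le> (\<integral>x. D / T \<partial>M)"
      by (intro integral_mono_AE) (auto intro: eventually_mono[OF M(3)] simp: fint pint p(2) less_imp_le)
    finally show ?thesis using fint pint by (simp add: mult.commute)
  qed
  have bN: "\<bar>(\<integral>x. f x \<partial>N) - (\<integral>x. p x \<partial>N)\<bar> \<le> D / T * measure N (space N)"
  proof -
    have "\<bar>\<integral>x. f x - p x \<partial>N\<bar> \<le> (\<integral>x. \<bar>f x - p x\<bar> \<partial>N)" by (rule integral_abs_bound)
    also have "\<dots> \<le> (\<integral>x. D / T \<partial>N)"
      by (intro integral_mono_AE) (auto intro: eventually_mono[OF N(3)] simp: fint pint p(2) less_imp_le)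
    finally show ?thesis using fint pint by (simp add: mult.commute)
  qed
  have "D \<le> D / T * (T - 1)"
    using bM bN p_eq unfolding D_def T_def by (simp add: distrib_left)
  then show False using \<open>D > 0\<close> \<open>T > 0\<close> by (simp add: field_simps)
qed

text \<open>Open half-lines determine a finite measure, and their indicators are bounded pointwise
  limits of continuous functions.\<close>

lemma measure_eq_if_moments_eq:
  fixes M N :: "real measure"
  assumes M: "finite_measure M" "sets M = sets borel" "AE x in M. x \<in> {0..1}"
    and N: "finite_measure N" "sets N = sets borel" "AE x in N. x \<in> {0..1}"
    and moments: "\<And>n. (\<integral>x. x ^ n \<partial>M) = (\<integral>x. x ^ n \<partial>N)"
  shows "M = N"
proof (rule measure_eqI_lessThan)
  interpret M: finite_measure M by fact
  interpret N: finite_measure N by fact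
  have [measurable_cong]: "sets M = sets borel" "sets N = sets borel" by fact+
  show "sets M = sets borel" "sets N = sets borel" by fact+
  show "emeasure M {x<..} < \<infinity>" for x by (simp add: less_top[symmetric])
  fix x :: real
  \<comment> \<open>For positive \<open>n\<close>, \<open>\<phi> n\<close> climbs linearly from 0 at
    \<open>x\<close> to 1 at \<open>x + 1 / n\<close>. The limit is the indicator of the open
    half-line because every \<open>\<phi> n\<close> vanishes at \<open>x\<close>.\<close>
  define \<phi> where "\<phi> n y = min 1 (max 0 (real n * (y - x)))" for n y
  have [measurable]: "\<phi> n \<in> borel_measurable borel" for n unfolding \<phi>_def by measurable
  have lim: "(\<lambda>n. \<phi> n y) \<longlonglongrightarrow> indicator {x<..} y" for y
  proof (cases "y > x")
    case True
    then obtain K :: nat where K: "real K * (y - x) > 1"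
      using ex_less_of_nat_mult[of "y - x" 1] by auto
    have "\<phi> n y = 1" if "n \<ge> K" for n
    proof -
      have "real K * (y - x) \<le> real n * (y - x)" using that True by (intro mult_right_mono) auto
      then show ?thesis using K by (simp add: \<phi>_def)
    qed
    then show ?thesis using True by (intro tendsto_eventually) (auto simp: eventually_sequentially)
  next
    case False
    then have "\<phi> n y = 0" for n by (simp add: \<phi>_def mult_nonneg_nonpos)
    then show ?thesis using False by simp
  qed
  have "(\<lambda>n. \<integral>y. \<phi> n y \<partial>M) \<longlonglongrightarrow> (\<integral>y. indicator {x<..} y \<partial>M)"
    by (rule integral_dominated_convergence[where w="\<lambda>_. 1"]) (use lim in \<open>auto simp: \<phi>_def\<close>)
  moreover have "(\<lambda>n. \<integral>y. \<phi> n y \<partial>N) \<longlonglongrightarrow> (\<integral>y. indicator {x<..} y \<partial>N)"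
    by (rule integral_dominated_convergence[where w="\<lambda>_. 1"]) (use lim in \<open>auto simp: \<phi>_def\<close>)
  moreover have "(\<integral>y. \<phi> n y \<partial>M) = (\<integral>y. \<phi> n y \<partial>N)" for n
    by (rule integral_eq_if_moments_eq[OF assms]) (auto simp: \<phi>_def intro!: continuous_intros)
  ultimately have "(\<integral>y. indicator {x<..} y \<partial>M) = (\<integral>y. indicat_real {x<..} y \<partial>N)"
    using LIMSEQ_unique by simp
  then show "emeasure M {x<..} = emeasure N {x<..}"
    by (simp add: M.emeasure_eq_measure N.emeasure_eq_measure)
qed

section \<open>Joint moments of several variables\<close>

lemma prod_list_unit_interval:
  fixes f :: "'v \<Rightarrow> real"
  assumes "\<And>v. v \<in> set vs \<Longrightarrow> f v \<in> {0..1}"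
  shows "prod_list (map f vs) \<in> {0..1}"
  using assms by (induction vs) (auto intro: mult_le_one)

lemma borel_measurable_prod_list:
  fixes f :: "'v \<Rightarrow> 'a \<Rightarrow> real"
  assumes "\<And>v. v \<in> set vs \<Longrightarrow> f v \<in> borel_measurable M"
  shows "(\<lambda>\<omega>. prod_list (map (\<lambda>v. f v \<omega>) vs)) \<in> borel_measurable M"
  using assms by (induction vs) auto

text \<open>The weight \<open>g\<close> will collect all variables but one. It turns a joint
  expectation into an integral against a finite measure on the unit interval, to which one-variable
  moment determinacy applies.\<close>

lemma moment_weighted_distr:
  fixes X g :: "'a \<Rightarrow> real"
  assumes "prob_space M" and [measurable]: "X \<in> borel_measurable M" "g \<in> borel_measurable M"
    and X: "\<And>\<omega>. X \<omega> \<in> {0..1}" and g: "\<And>\<omega>. g \<omega> \<in> {0..1}"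
  defines "K \<equiv> distr (density M (\<lambda>\<omega>. ennreal (g \<omega>))) borel X"
  shows "finite_measure K" "AE x in K. x \<in> {0..1}"
    and "\<And>h. h \<in> borel_measurable borel \<Longrightarrow> (\<integral>x. h x \<partial>K) = (\<integral>\<omega>. h (X \<omega>) * g \<omega> \<partial>M)"
proof -
  interpret prob_space M by fact
  have "(\<integral>\<^sup>+\<omega>. ennreal (g \<omega>) \<partial>M) \<le> (\<integral>\<^sup>+\<omega>. 1 \<partial>M)"
    using g by (intro nn_integral_mono) auto
  then have "emeasure (density M (\<lambda>\<omega>. ennreal (g \<omega>))) (space M) < \<infinity>"
    by (auto simp: emeasure_density emeasure_space_1 nn_integral_multc cong: nn_integral_cong intro: le_less_trans)
  then have "finite_measure (density M (\<lambda>\<omega>. ennreal (g \<omega>)))"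
    by (intro finite_measureI) auto
  then show "finite_measure K"
    unfolding K_def by (intro finite_measure.finite_measure_distr) auto
  show "AE x in K. x \<in> {0..1}"
    unfolding K_def using X by (subst AE_distr_iff) auto
  fix h :: "real \<Rightarrow> real" assume [measurable]: "h \<in> borel_measurable borel"
  show "(\<integral>x. h x \<partial>K) = (\<integral>\<omega>. h (X \<omega>) * g \<omega> \<partial>M)"
    unfolding K_def using g
    by (subst integral_distr) (auto simp: integral_density mult.commute)
qed

lemma mixed_product_measurable:
  fixes Z :: "'v \<Rightarrow> 'a \<Rightarrow> real"
  assumes "\<And>v. v \<in> V \<Longrightarrow> Z v \<in> borel_measurable M"
    and "set L \<subseteq> V \<times> sets borel" "set vs \<subseteq> V"
  shows "(\<lambda>\<omega>. prod_list (map (\<lambda>(v, B). indicator B (Z v \<omega>)) L) * prod_list (map (\<lambda>v. Z v \<omega>) vs))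
    \<in> borel_measurable M"
proof -
  have "(\<lambda>\<omega>. prod_list (map (\<lambda>q. case q of (v, B) \<Rightarrow> indicat_real B (Z v \<omega>)) L)) \<in> borel_measurable M"
  proof (rule borel_measurable_prod_list)
    fix q assume "q \<in> set L"
    then obtain v B where q: "q = (v, B)" and [measurable]: "B \<in> sets borel" and v: "v \<in> V"
      using assms(2) by (cases q) auto
    have [measurable]: "Z v \<in> borel_measurable M" by (rule assms) fact
    show "(\<lambda>\<omega>. case q of (v, B) \<Rightarrow> indicat_real B (Z v \<omega>)) \<in> borel_measurable M"
      unfolding q prod.case by measurable
  qed
  then show ?thesis
    by (intro borel_measurable_times borel_measurable_prod_list) (use assms in auto)
qed

lemma mixed_product_unit:
  fixes Z :: "'v \<Rightarrow> 'a \<Rightarrow> real"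
  assumes "\<And>v \<omega>. Z v \<omega> \<in> {0..1}"
  shows "prod_list (map (\<lambda>(v, B). indicator B (Z v \<omega>)) L) * prod_list (map (\<lambda>v. Z v \<omega>) vs) \<in> {0..1}"
proof -
  have "prod_list (map (\<lambda>(v, B). indicator B (Z v \<omega>)) L) \<in> {0..1::real}"
    by (rule prod_list_unit_interval) (auto split: split_indicator)
  moreover have "prod_list (map (\<lambda>v. Z v \<omega>) vs) \<in> {0..1}"
    by (rule prod_list_unit_interval) (rule assms)
  ultimately show ?thesis by (auto intro: mult_le_one)
qed

text \<open>The variables are exchanged one at a time: moments of one variable under the measure weighted by
  all other factors are joint moments, so they determine the weighted law of that variable.\<close>
lemma integral_indicators_eq_if_joint_moments_eq:
  fixes X :: "'v \<Rightarrow> 'a \<Rightarrow> real" and Y :: "'v \<Rightarrow> 'b \<Rightarrow> real"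
  assumes M: "prob_space M" and N: "prob_space N"
    and X: "\<And>v. v \<in> V \<Longrightarrow> X v \<in> borel_measurable M" "\<And>v \<omega>. X v \<omega> \<in> {0..1}"
    and Y: "\<And>v. v \<in> V \<Longrightarrow> Y v \<in> borel_measurable N" "\<And>v \<omega>. Y v \<omega> \<in> {0..1}"
    and moments: "\<And>vs. set vs \<subseteq> V \<Longrightarrow>
      (\<integral>\<omega>. prod_list (map (\<lambda>v. X v \<omega>) vs) \<partial>M) = (\<integral>\<omega>. prod_list (map (\<lambda>v. Y v \<omega>) vs) \<partial>N)"
    and L: "set L \<subseteq> V \<times> sets borel" and vs: "set vs \<subseteq> V"
  shows "(\<integral>\<omega>. prod_list (map (\<lambda>(v, B). indicator B (X v \<omega>)) L) * prod_list (map (\<lambda>v. X v \<omega>) vs) \<partial>M)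
       = (\<integral>\<omega>. prod_list (map (\<lambda>(v, B). indicator B (Y v \<omega>)) L) * prod_list (map (\<lambda>v. Y v \<omega>) vs) \<partial>N)"
  using L vs
proof (induction L arbitrary: vs)
  case Nil
  then show ?case using moments by simp
next
  case (Cons q L)
  obtain v B where q: "q = (v, B)" by (cases q)
  have v: "v \<in> V" and B[measurable]: "B \<in> sets borel" and L: "set L \<subseteq> V \<times> sets borel"
    using Cons.prems q by auto
  let ?g = "\<lambda>Z \<omega>. prod_list (map (\<lambda>(v, B). indicator B (Z v \<omega>)) L) * prod_list (map (\<lambda>v. Z v \<omega>) vs)"
  have vs: "set vs \<subseteq> V" by fact
  have gX_meas: "?g X \<in> borel_measurable M" by (rule mixed_product_measurable[OF X(1) L vs])
  have gX_unit: "?g X \<omega> \<in> {0..1}" for \<omega> by (rule mixed_product_unit[OF X(2)])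
  have gY_meas: "?g Y \<in> borel_measurable N" by (rule mixed_product_measurable[OF Y(1) L vs])
  have gY_unit: "?g Y \<omega> \<in> {0..1}" for \<omega> by (rule mixed_product_unit[OF Y(2)])
  note gX = moment_weighted_distr[OF M X(1)[OF v] gX_meas X(2) gX_unit]
  note gY = moment_weighted_distr[OF N Y(1)[OF v] gY_meas Y(2) gY_unit]
  let ?K = "distr (density M (\<lambda>\<omega>. ennreal (?g X \<omega>))) borel (X v)"
  let ?K' = "distr (density N (\<lambda>\<omega>. ennreal (?g Y \<omega>))) borel (Y v)"
  have "?K = ?K'"
  proof (rule measure_eq_if_moments_eq)
    fix n
    have "(\<integral>x. x ^ n \<partial>?K) = (\<integral>\<omega>. X v \<omega> ^ n * ?g X \<omega> \<partial>M)" by (rule gX) auto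
    also have "\<dots> = (\<integral>\<omega>. Y v \<omega> ^ n * ?g Y \<omega> \<partial>N)"
      \<comment> \<open>Prepending \<open>n\<close> copies of \<open>v\<close> to \<open>vs\<close>
        supplies the power of \<open>X v\<close>. This is why the statement carries moment factors
        next to the indicators and why the induction varies \<open>vs\<close>.\<close>
      using Cons.IH[OF L, of "replicate n v @ vs"] Cons.prems v
      by (auto simp: mult_ac set_replicate_conv_if)
    also have "\<dots> = (\<integral>x. x ^ n \<partial>?K')" by (rule gY(3)[symmetric]) auto
    finally show "(\<integral>x. x ^ n \<partial>?K) = (\<integral>x. x ^ n \<partial>?K')" .
  qed (use gX gY in auto)
  then have "(\<integral>\<omega>. indicator B (X v \<omega>) * ?g X \<omega> \<partial>M) = (\<integral>\<omega>. indicator B (Y v \<omega>) * ?g Y \<omega> \<partial>N)"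
    using gX(3)[of "indicator B"] gY(3)[of "indicator B"] by simp
  then show ?case by (simp add: q mult_ac)
qed

section \<open>Laplace exponents\<close>

text \<open>\<open>exp (t * s)\<close> is expanded in \<open>t\<close> and integrated term by term.
  On a finite measure the constant 1 dominates: for \<open>|t| \<le> x\<close> the partial sums are
  at most \<open>exp (- x * s) * exp (x * s)\<close> in absolute value, which also admits the
  boundary \<open>|t| = x\<close>.\<close>

lemma laplace_transform_power_series:
  fixes \<nu> :: "real measure"
  assumes "finite_measure \<nu>" and sets: "sets \<nu> = sets borel" and pos: "AE s in \<nu>. 0 < s"
    and x: "0 < x" and t: "\<bar>t\<bar> \<le> x"
  shows "(\<lambda>n. (\<integral>s. s ^ n * exp (- x * s) / fact n \<partial>\<nu>) * t ^ n) sums (\<integral>s. exp (- (x - t) * s) \<partial>\<nu>)"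
proof -
  interpret finite_measure \<nu> by fact
  have [measurable_cong]: "sets \<nu> = sets borel" by fact
  have exp_sums: "(\<lambda>n. (y * s) ^ n / fact n) sums exp (y * s)" for y s :: real
    using exp_converges[of "y * s"] by (simp add: divide_inverse mult.commute)
  have partial: "(\<Sum>n<N. (x * s) ^ n / fact n) \<le> exp (x * s)" if "0 < s" for N s
    using sum_le_suminf[of "\<lambda>n. (x * s) ^ n / fact n" "{..<N}"] exp_sums[of x s] that x
    by (auto simp: sums_iff)
  have int: "integrable \<nu> (\<lambda>s. s ^ n * exp (- x * s) / fact n)" for n
  proof (rule integrable_const_bound[where B="1 / x ^ n"])
    show "AE s in \<nu>. norm (s ^ n * exp (- x * s) / fact n) \<le> 1 / x ^ n"
      using pos
    proof eventually_elim
      case (elim s)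
      \<comment> \<open>One term of the exponential series is at most its sum; this bounds the
        integrand by \<open>1 / x ^ n\<close>.\<close>
      have "(x * s) ^ n / fact n \<le> (\<Sum>k<Suc n. (x * s) ^ k / fact k)"
        using elim x by (intro member_le_sum) auto
      also have "\<dots> \<le> exp (x * s)" by (rule partial[OF elim])
      finally show ?case using elim x by (simp add: field_simps power_mult_distrib exp_minus)
    qed
  qed measurable
  have "(\<lambda>N. \<integral>s. (\<Sum>n<N. (s ^ n * exp (- x * s) / fact n) * t ^ n) \<partial>\<nu>)
      \<longlonglongrightarrow> (\<integral>s. exp (- (x - t) * s) \<partial>\<nu>)"
  proof (rule integral_dominated_convergence[where w="\<lambda>_. 1"])
    show "AE s in \<nu>. (\<lambda>N. \<Sum>n<N. (s ^ n * exp (- x * s) / fact n) * t ^ n) \<longlonglongrightarrow> exp (- (x - t) * s)"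
    proof (rule AE_I2)
      fix s
      have "(\<lambda>n. exp (- x * s) * ((t * s) ^ n / fact n)) sums (exp (- x * s) * exp (t * s))"
        by (intro sums_mult exp_sums)
      also have "exp (- x * s) * exp (t * s) = exp (- (x - t) * s)"
        by (simp add: exp_add[symmetric] algebra_simps)
      finally show "(\<lambda>N. \<Sum>n<N. (s ^ n * exp (- x * s) / fact n) * t ^ n) \<longlonglongrightarrow> exp (- (x - t) * s)"
        by (simp add: sums_def power_mult_distrib mult_ac)
    qed
    show "AE s in \<nu>. norm (\<Sum>n<N. (s ^ n * exp (- x * s) / fact n) * t ^ n) \<le> 1" for N
      using pos
    proof eventually_elim
      case (elim s)
      have "norm (\<Sum>n<N. (s ^ n * exp (- x * s) / fact n) * t ^ n)
          \<le> (\<Sum>n<N. exp (- x * s) * ((x * s) ^ n / fact n))"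
      proof (rule sum_norm_le)
        fix n
        have "\<bar>t\<bar> ^ n \<le> x ^ n" using t by (intro power_mono) auto
        then show "norm ((s ^ n * exp (- x * s) / fact n) * t ^ n) \<le> exp (- x * s) * ((x * s) ^ n / fact n)"
          using elim x by (simp add: abs_mult power_abs power_mult_distrib divide_simps mult_ac)
      qed
      also have "\<dots> \<le> exp (- x * s) * exp (x * s)"
        unfolding sum_distrib_left[symmetric] by (intro mult_left_mono partial elim) auto
      finally show ?case by (simp add: exp_add[symmetric])
    qed
  qed auto
  moreover have "(\<integral>s. (\<Sum>n<N. (s ^ n * exp (- x * s) / fact n) * t ^ n) \<partial>\<nu>)
      = (\<Sum>n<N. (\<integral>s. s ^ n * exp (- x * s) / fact n \<partial>\<nu>) * t ^ n)" for N
    by (subst Bochner_Integration.integral_sum, rule integrable_mult_left, rule int,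
        simp only: integral_mult_left_zero)
  ultimately show ?thesis by (simp only: sums_def)
qed

text \<open>The power series at \<open>x < r\<close> converges on all of \<open>(0, 2x)\<close>; this replaces analytic continuation.\<close>
lemma laplace_transform_eq_doubling:
  fixes \<nu> \<nu>' :: "real measure"
  assumes \<nu>: "finite_measure \<nu>" "sets \<nu> = sets borel" "AE s in \<nu>. 0 < s"
    and \<nu>': "finite_measure \<nu>'" "sets \<nu>' = sets borel" "AE s in \<nu>'. 0 < s"
    and eq: "\<And>x. 0 < x \<Longrightarrow> x < r \<Longrightarrow> (\<integral>s. exp (- x * s) \<partial>\<nu>) = (\<integral>s. exp (- x * s) \<partial>\<nu>')"
    and y: "0 < y" "y < 2 * r"
  shows "(\<integral>s. exp (- y * s) \<partial>\<nu>) = (\<integral>s. exp (- y * s) \<partial>\<nu>')"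
proof -
  \<comment> \<open>\<open>x\<close> is the midpoint of \<open>y / 2\<close> and \<open>r\<close>:
    below \<open>r\<close>, where the transforms agree, and above \<open>y / 2\<close>, so that the
    power series around \<open>x\<close> reaches \<open>y\<close>.\<close>
  define x where "x = (y / 2 + r) / 2"
  have x: "0 < x" "x < r" "\<bar>x - y\<bar> \<le> x" using y by (auto simp: x_def abs_if field_simps)
  define a where "a n = (\<integral>s. s ^ n * exp (- x * s) / fact n \<partial>\<nu>) - (\<integral>s. s ^ n * exp (- x * s) / fact n \<partial>\<nu>')"
    for n :: nat
  define f where "f t = (\<integral>s. exp (- (x - t) * s) \<partial>\<nu>) - (\<integral>s. exp (- (x - t) * s) \<partial>\<nu>')" for t
  have sums: "(\<lambda>n. a n * t ^ n) sums f t" if "\<bar>t\<bar> \<le> x" for t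
    unfolding a_def f_def left_diff_distrib
    by (intro sums_diff laplace_transform_power_series \<nu> \<nu>' x that)
  have f0: "f t = 0" if "\<bar>t\<bar> < min x (r - x)" for t
    using eq[of "x - t"] that by (auto simp: f_def)
  \<comment> \<open>The constant coefficient is \<open>f 0 = 0\<close>. Any other nonzero
    coefficient would make 0 an isolated zero of \<open>f\<close>, but \<open>f\<close> vanishes
    near 0.\<close>
  have "a n = 0" for n
  proof (cases "n = 0")
    case True
    have "(\<lambda>n. a n * 0 ^ n) sums f 0" using x by (intro sums) auto
    then have "a 0 = f 0" using powser_sums_zero_iff by blast
    then show ?thesis using True f0[of 0] x by simp
  next
    case False
    show ?thesis
    proof (rule ccontr)
      assume "a n \<noteq> 0"
      then obtain e where e: "0 < e" "\<And>z. z \<in> cball 0 e - {0} \<Longrightarrow> f z \<noteq> 0"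
        using powser_0_nonzero[of x 0 a f n] False x sums f0[of 0] by (auto simp: less_imp_le)
      define z where "z = min e (min x (r - x) / 2)"
      have "z \<in> cball 0 e - {0}" "\<bar>z\<bar> < min x (r - x)" using e(1) x by (auto simp: z_def min_def)
      then show False using e(2) f0 by blast
    qed
  qed
  then have "f (x - y) = 0" using sums[OF x(3)] by (simp add: sums_iff)
  then show ?thesis by (simp add: f_def)
qed

text \<open>Iterating the doubling \<open>n\<close> times reaches \<open>2 ^ n * r\<close>, hence
  every positive argument.\<close>

lemma laplace_transform_eq_extend:
  fixes \<nu> \<nu>' :: "real measure"
  assumes \<nu>: "finite_measure \<nu>" "sets \<nu> = sets borel" "AE s in \<nu>. 0 < s"
    and \<nu>': "finite_measure \<nu>'" "sets \<nu>' = sets borel" "AE s in \<nu>'. 0 < s"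
    and r: "0 < r"
    and eq: "\<And>x. 0 < x \<Longrightarrow> x < r \<Longrightarrow> (\<integral>s. exp (- x * s) \<partial>\<nu>) = (\<integral>s. exp (- x * s) \<partial>\<nu>')"
    and y: "0 < y"
  shows "(\<integral>s. exp (- y * s) \<partial>\<nu>) = (\<integral>s. exp (- y * s) \<partial>\<nu>')"
proof -
  have *: "(\<integral>s. exp (- y * s) \<partial>\<nu>) = (\<integral>s. exp (- y * s) \<partial>\<nu>')" if "0 < y" "y < 2 ^ n * r" for n y
    using that
  proof (induction n arbitrary: y)
    case 0
    then show ?case using eq by simp
  next
    case (Suc n)
    show ?case
      by (rule laplace_transform_eq_doubling[OF \<nu> \<nu>' Suc.IH]) (use Suc.prems in auto)
  qed
  obtain n where "y / r < 2 ^ n" using real_arch_pow[of 2 "y / r"] by auto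
  then show ?thesis using *[of y n] y r by (simp add: field_simps)
qed

section \<open>Elementary properties of Laplace exponents\<close>

lemma levy_pos: "levy_measure \<rho> \<Longrightarrow> AE s in \<rho>. 0 < s"
  by (auto simp: levy_measure_def intro!: AE_I[where N="{..0}"])

text \<open>The integrand is at most 1, which settles large \<open>s\<close>, and at most
  \<open>t * s\<close>, which settles small \<open>s\<close>: these match the two finiteness
  conditions in \<open>levy_measure\<close>.\<close>

lemma levy_integrable:
  assumes \<rho>: "levy_measure \<rho>" and t: "0 \<le> t"
  shows "integrable \<rho> (\<lambda>s. 1 - exp (- t * s))"
proof -
  have sets[measurable_cong]: "sets \<rho> = sets borel" using \<rho> by (simp add: levy_measure_def)
  \<comment> \<open>The cut-offs 1/2 and 1 overlap, so that the two open sets cover the whole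
    positive half-line.\<close>
  have fin: "emeasure \<rho> {1/2<..} < \<infinity>" "(\<integral>\<^sup>+ s. ennreal s * indicator {0<..<1} s \<partial>\<rho>) < \<infinity>"
    using \<rho> by (auto simp: levy_measure_def)
  have int1: "integrable \<rho> (indicat_real {1/2<..})"
    using fin(1) sets by (intro integrable_real_indicator) auto
  have int2: "integrable \<rho> (\<lambda>s. s * indicat_real {0<..<1} s)"
  proof (rule integrableI_nonneg)
    show "AE s in \<rho>. 0 \<le> s * indicat_real {0<..<1} s" by (auto split: split_indicator)
    have "(\<integral>\<^sup>+ s. ennreal (s * indicat_real {0<..<1} s) \<partial>\<rho>) = (\<integral>\<^sup>+ s. ennreal s * indicator {0<..<1} s \<partial>\<rho>)"
      by (intro nn_integral_cong) (auto split: split_indicator)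
    then show "(\<integral>\<^sup>+ s. ennreal (s * indicat_real {0<..<1} s) \<partial>\<rho>) < \<infinity>" using fin by simp
  qed measurable
  have "integrable \<rho> (\<lambda>s. indicat_real {1/2<..} s + t * (s * indicat_real {0<..<1} s))"
    using int1 int2 by auto
  then show ?thesis
  proof (rule Bochner_Integration.integrable_bound)
    show "AE s in \<rho>. norm (1 - exp (- t * s)) \<le> norm (indicat_real {1/2<..} s + t * (s * indicat_real {0<..<1} s))"
      using levy_pos[OF \<rho>]
    proof eventually_elim
      case (elim s)
      have "1 - exp (- t * s) \<le> t * s" using exp_ge_add_one_self[of "- t * s"] by simp
      moreover have "exp (- t * s) \<le> 1" "0 < exp (- t * s)" using elim t by auto
      ultimately show ?case using elim t by (auto split: split_indicator simp: field_simps)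
    qed
  qed measurable
qed

lemma laplace_exp_zero [simp]: "laplace_exp \<rho> 0 = 0"
  by (simp add: laplace_exp_def)

text \<open>The exponentials alone need not be integrable, as \<open>\<rho>\<close> may have
  infinite mass near 0; their differences are.\<close>

lemma laplace_exp_diff:
  assumes "levy_measure \<rho>" "0 \<le> a" "0 \<le> b"
  shows "laplace_exp \<rho> b - laplace_exp \<rho> a = (\<integral>s. exp (- a * s) - exp (- b * s) \<partial>\<rho>)"
    and "integrable \<rho> (\<lambda>s. exp (- a * s) - exp (- b * s))"
proof -
  have "integrable \<rho> (\<lambda>s. (1 - exp (- b * s)) - (1 - exp (- a * s)))"
    by (intro Bochner_Integration.integrable_diff levy_integrable assms)
  then show "integrable \<rho> (\<lambda>s. exp (- a * s) - exp (- b * s))" by simp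
  have "laplace_exp \<rho> b - laplace_exp \<rho> a = (\<integral>s. (1 - exp (- b * s)) - (1 - exp (- a * s)) \<partial>\<rho>)"
    unfolding laplace_exp_def
    by (rule Bochner_Integration.integral_diff[symmetric]; intro levy_integrable assms)
  then show "laplace_exp \<rho> b - laplace_exp \<rho> a = (\<integral>s. exp (- a * s) - exp (- b * s) \<partial>\<rho>)" by simp
qed

lemma laplace_exp_mono:
  assumes "levy_measure \<rho>" "0 \<le> a" "a \<le> b"
  shows "laplace_exp \<rho> a \<le> laplace_exp \<rho> b"
proof -
  have "0 \<le> (\<integral>s. exp (- a * s) - exp (- b * s) \<partial>\<rho>)"
    using levy_pos[OF assms(1)] assms by (intro integral_nonneg_AE) (auto elim!: eventually_mono)
  then show ?thesis using laplace_exp_diff(1)[of \<rho> a b] assms by simp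
qed

lemma laplace_exp_nonneg: "levy_measure \<rho> \<Longrightarrow> 0 \<le> t \<Longrightarrow> 0 \<le> laplace_exp \<rho> t"
  using laplace_exp_mono[of \<rho> 0 t] by simp

text \<open>Equal values would give a nonnegative integrand with zero integral, hence vanishing
  almost everywhere, although it is positive at every \<open>s > 0\<close>, where all the mass
  lies.\<close>

lemma laplace_exp_strict_mono:
  assumes \<rho>: "levy_measure \<rho>" "\<rho> \<noteq> null_measure borel" and ab: "0 \<le> a" "a < b"
  shows "laplace_exp \<rho> a < laplace_exp \<rho> b"
proof (rule ccontr)
  have sets: "sets \<rho> = sets borel" using \<rho> by (simp add: levy_measure_def)
  assume "\<not> ?thesis"
  then have "laplace_exp \<rho> b - laplace_exp \<rho> a = 0" using laplace_exp_mono[of \<rho> a b] assms by auto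
  then have "(\<integral>s. exp (- a * s) - exp (- b * s) \<partial>\<rho>) = 0"
    using laplace_exp_diff(1)[of \<rho> a b] assms by simp
  then have "AE s in \<rho>. exp (- a * s) - exp (- b * s) = 0"
    using levy_pos[OF \<rho>(1)] ab laplace_exp_diff(2)[of \<rho> a b] \<rho>
    by (subst integral_nonneg_eq_0_iff_AE[symmetric]) (auto elim!: eventually_mono)
  then have "AE s in \<rho>. False" using levy_pos[OF \<rho>(1)]
    by eventually_elim (use ab in auto)
  then have "emeasure \<rho> (space \<rho>) = 0" by (simp add: AE_iff_null null_sets_def)
  then have "\<rho> = null_measure borel"
    using sets sets_eq_imp_space_eq[OF sets]
    by (intro measure_eqI) (auto intro: emeasure_eq_0 sets.sets_into_space)
  then show False using \<rho> by simp
qed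

lemma laplace_exp_continuous:
  assumes \<rho>: "levy_measure \<rho>"
  shows "continuous_on {0..} (laplace_exp \<rho>)"
proof (rule continuous_on_sequentiallyI)
  fix u :: "nat \<Rightarrow> real" and a
  assume u: "\<forall>n. u n \<in> {0..}" and a: "a \<in> {0..}" and lim: "u \<longlonglongrightarrow> a"
  have [measurable_cong]: "sets \<rho> = sets borel" using \<rho> by (simp add: levy_measure_def)
  \<comment> \<open>A convergent sequence is bounded by some \<open>T\<close>, and monotonicity in
    the rate makes the integrand at \<open>T\<close> a dominating function.\<close>
  obtain T where T: "\<And>n. u n \<le> T"
    using convergent_imp_Bseq[OF convergentI[OF lim]] by (auto simp: Bseq_def abs_le_iff)
  then have "0 \<le> T" using u order_trans by (metis atLeast_iff)
  show "(\<lambda>n. laplace_exp \<rho> (u n)) \<longlonglongrightarrow> laplace_exp \<rho> a"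
    unfolding laplace_exp_def
  proof (rule integral_dominated_convergence[where w="\<lambda>s. 1 - exp (- T * s)"])
    show "integrable \<rho> (\<lambda>s. 1 - exp (- T * s))" using \<rho> \<open>0 \<le> T\<close> by (rule levy_integrable)
    show "AE s in \<rho>. (\<lambda>n. 1 - exp (- u n * s)) \<longlonglongrightarrow> 1 - exp (- a * s)"
      by (intro AE_I2 tendsto_intros lim)
    show "AE s in \<rho>. norm (1 - exp (- u n * s)) \<le> 1 - exp (- T * s)" for n
      using levy_pos[OF \<rho>]
    proof eventually_elim
      case (elim s)
      have "u n * s \<ge> 0" "u n * s \<le> T * s" using u T elim by (auto intro: mult_right_mono)
      then show ?case by auto
    qed
  qed measurable
qed

text \<open>Agreement is assumed near zero only, because outer exponents get compared only on the
  range of an inner one. Weighting by \<open>1 - exp (- h * s)\<close> gives a finite measure,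
  agreement of its transform extends to all arguments, and moments on the unit interval then
  identify it.\<close>

lemma laplace_exp_inject:
  assumes \<rho>: "levy_measure \<rho>" and \<rho>': "levy_measure \<rho>'" and r: "0 < r"
    and eq: "\<And>x. 0 \<le> x \<Longrightarrow> x < r \<Longrightarrow> laplace_exp \<rho> x = laplace_exp \<rho>' x"
  shows "\<rho> = \<rho>'"
proof -
  \<comment> \<open>Half of \<open>r\<close>, so that \<open>x\<close> and \<open>x + h\<close> both
    stay below \<open>r\<close> for every \<open>x < h\<close>.\<close>
  define h where "h = r / 2"
  have h: "0 < h" using r by (simp add: h_def)
  txt \<open>The tilted measure is finite and its Laplace transform is an increment of the Laplace exponent.\<close>
  define N where "N \<rho> = density \<rho> (\<lambda>s. ennreal (1 - exp (- h * s)))" for \<rho> :: "real measure"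
  \<comment> \<open>After the map to \<open>exp (- s)\<close>, the \<open>n\<close>-th moment is the
    transform at the integer \<open>n\<close>.\<close>
  define K where "K \<rho> = distr (N \<rho>) borel (\<lambda>s. exp (- s))" for \<rho> :: "real measure"
  have *: "finite_measure (N \<rho>) \<and> sets (N \<rho>) = sets borel \<and> (AE s in N \<rho>. 0 < s)
      \<and> (\<forall>x\<ge>0. (\<integral>s. exp (- x * s) \<partial>N \<rho>) = laplace_exp \<rho> (x + h) - laplace_exp \<rho> x)
      \<and> finite_measure (K \<rho>) \<and> (AE s in K \<rho>. s \<in> {0..1}) 
      \<and> (\<forall>n. (\<integral>s. s ^ n \<partial>K \<rho>) = laplace_exp \<rho> (real n + h) - laplace_exp \<rho> (real n))
      \<and> \<rho> = density (distr (K \<rho>) borel (\<lambda>x. - ln x)) (\<lambda>s. ennreal (1 / (1 - exp (- h * s))))"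
    if \<rho>: "levy_measure \<rho>" for \<rho>
  proof (intro conjI allI impI)
    have sets[measurable_cong]: "sets \<rho> = sets borel" using \<rho> by (simp add: levy_measure_def)
    note pos = levy_pos[OF \<rho>]
    show sN[measurable_cong]: "sets (N \<rho>) = sets borel" by (simp add: N_def sets)
    have nonneg: "AE s in \<rho>. 0 \<le> 1 - exp (- h * s)" using pos h by (auto elim!: eventually_mono)
    have "emeasure (N \<rho>) (space (N \<rho>)) = (\<integral>\<^sup>+ s. ennreal (1 - exp (- h * s)) \<partial>\<rho>)"
      by (simp add: N_def emeasure_density cong: nn_integral_cong)
    also have "\<dots> = ennreal (laplace_exp \<rho> h)"
      unfolding laplace_exp_def
      by (rule nn_integral_eq_integral) (use levy_integrable[OF \<rho>, of h] h nonneg in auto)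
    finally show fN: "finite_measure (N \<rho>)" by (intro finite_measureI) auto
    show pN: "AE s in N \<rho>. 0 < s" unfolding N_def using pos by (subst AE_density) (auto elim!: eventually_mono)
    show L: "(\<integral>s. exp (- x * s) \<partial>N \<rho>) = laplace_exp \<rho> (x + h) - laplace_exp \<rho> x" if "0 \<le> x" for x
    proof -
      have "(\<integral>s. exp (- x * s) \<partial>N \<rho>) = (\<integral>s. (1 - exp (- h * s)) * exp (- x * s) \<partial>\<rho>)"
        unfolding N_def using nonneg by (subst integral_density) auto
      also have "\<dots> = (\<integral>s. exp (- x * s) - exp (- (x + h) * s) \<partial>\<rho>)"
        by (intro Bochner_Integration.integral_cong) (auto simp: algebra_simps exp_add[symmetric])
      finally show ?thesis using laplace_exp_diff(1)[OF \<rho> that, of "x + h"] that h by simp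
    qed
    show "finite_measure (K \<rho>)" unfolding K_def by (rule finite_measure.finite_measure_distr[OF fN]) measurable
    show "AE s in K \<rho>. s \<in> {0..1}"
      unfolding K_def using pN by (subst AE_distr_iff) (auto elim!: eventually_mono)
    fix n
    have "(\<integral>s. s ^ n \<partial>K \<rho>) = (\<integral>s. exp (- real n * s) \<partial>N \<rho>)"
      unfolding K_def by (subst integral_distr) (auto simp: exp_of_nat_mult[symmetric])
    then show "(\<integral>s. s ^ n \<partial>K \<rho>) = laplace_exp \<rho> (real n + h) - laplace_exp \<rho> (real n)"
      using L[of "real n"] by simp
    \<comment> \<open>The map \<open>- ln x\<close> inverts \<open>exp (- s)\<close>, and the
      reciprocal weight undoes the tilt, which is positive almost everywhere. So
      \<open>K \<rho>\<close> determines \<open>\<rho>\<close>.\<close>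
    have "distr (K \<rho>) borel (\<lambda>x. - ln x) = N \<rho>"
      unfolding K_def by (subst distr_distr) (auto simp: comp_def sN intro!: distr_id2)
    moreover have "density (N \<rho>) (\<lambda>s. ennreal (1 / (1 - exp (- h * s)))) = density \<rho> (\<lambda>_. 1)"
      unfolding N_def
    proof (subst density_density_eq)
      show "density \<rho> (\<lambda>x. ennreal (1 - exp (- h * x)) * ennreal (1 / (1 - exp (- h * x)))) = density \<rho> (\<lambda>_. 1)"
      proof (rule density_cong)
        show "AE x in \<rho>. ennreal (1 - exp (- h * x)) * ennreal (1 / (1 - exp (- h * x))) = 1"
          using pos
        proof eventually_elim
          case (elim s)
          have "ennreal p * ennreal (1 / p) = 1" if "p > 0" for p
            using that by (simp add: ennreal_mult[symmetric])
          then show ?case using elim h by simp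
        qed
      qed measurable
    qed measurable
    ultimately show "\<rho> = density (distr (K \<rho>) borel (\<lambda>x. - ln x)) (\<lambda>s. ennreal (1 / (1 - exp (- h * s))))"
      by (simp add: density_1)
  qed
  have L: "(\<integral>s. exp (- x * s) \<partial>N \<rho>) = (\<integral>s. exp (- x * s) \<partial>N \<rho>')" if "0 \<le> x" for x
  \<comment> \<open>The extension covers positive arguments only; at 0 the transform is the exponent
    at \<open>h\<close>, and \<open>h\<close> is below \<open>r\<close>.\<close>
  proof (cases "x = 0")
    case True
    have "laplace_exp \<rho> h = laplace_exp \<rho>' h" using r by (intro eq) (auto simp: h_def)
    moreover have "(\<integral>s. exp (- x * s) \<partial>N \<rho>) = laplace_exp \<rho> (x + h) - laplace_exp \<rho> x"
      "(\<integral>s. exp (- x * s) \<partial>N \<rho>') = laplace_exp \<rho>' (x + h) - laplace_exp \<rho>' x"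
      using *[OF \<rho>] *[OF \<rho>'] that by blast+
    ultimately show ?thesis using True by simp
  next
    case False
    show ?thesis
    proof (rule laplace_transform_eq_extend[where r=h])
      show "(\<integral>s. exp (- x * s) \<partial>N \<rho>) = (\<integral>s. exp (- x * s) \<partial>N \<rho>')" if "0 < x" "x < h" for x
        using *[OF \<rho>] *[OF \<rho>'] eq[of x] eq[of "x + h"] that by (simp add: h_def)
    qed (use *[OF \<rho>] *[OF \<rho>'] h that False in auto)
  qed
  have "K \<rho> = K \<rho>'"
  proof (rule measure_eq_if_moments_eq)
    fix n
    show "(\<integral>x. x ^ n \<partial>K \<rho>) = (\<integral>x. x ^ n \<partial>K \<rho>')"
      using *[OF \<rho>] *[OF \<rho>'] L[of "real n"] by simp
  qed (use *[OF \<rho>] *[OF \<rho>'] in \<open>auto simp: K_def\<close>)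
  then show ?thesis using *[OF \<rho>] *[OF \<rho>'] by metis
qed

section \<open>The law of a hierarchical vector\<close>

lemma expneg_zero [simp]: "expneg 0 x = 1"
  by (simp add: expneg_def)

lemma expneg_unit: "0 \<le> t \<Longrightarrow> expneg t x \<in> {0..1}"
  by (auto simp: expneg_def)

text \<open>Nonnegative rates matter at infinity: opposite nonzero rates would give
  \<open>expneg 0 \<infinity> = 1\<close> on the left but 0 on the right.\<close>

lemma expneg_add_rate: "0 \<le> a \<Longrightarrow> 0 \<le> b \<Longrightarrow> expneg (a + b) x = expneg a x * expneg b x"
  by (auto simp: expneg_def algebra_simps exp_add[symmetric])

lemma expneg_sum_rate:
  "finite I \<Longrightarrow> (\<And>i. i \<in> I \<Longrightarrow> 0 \<le> a i) \<Longrightarrow> expneg (\<Sum>i\<in>I. a i) x = (\<Prod>i\<in>I. expneg (a i) x)"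
  by (induction I rule: finite_induct) (auto simp: expneg_add_rate sum_nonneg)

lemma expneg_add: "expneg t (x + y) = expneg t x * expneg t y"
  by (auto simp: expneg_def enn2real_plus less_top algebra_simps exp_add[symmetric])

lemma expneg_sum: "finite J \<Longrightarrow> expneg t (\<Sum>j\<in>J. x j) = (\<Prod>j\<in>J. expneg t (x j))"
  by (induction J rule: finite_induct) (auto simp: expneg_add, simp add: expneg_def)

lemma expneg_measurable [measurable]: "expneg t \<in> borel_measurable borel"
  unfolding expneg_def[abs_def] by measurable

text \<open>The left inverse of \<open>expneg 1\<close>, so that evaluations may be replaced by variables in \<open>[0, 1]\<close>.\<close>
definition neglog :: "real \<Rightarrow> ennreal" where
  "neglog x = (if x \<le> 0 then \<infinity> else ennreal (- ln x))"

lemma neglog_measurable [measurable]: "neglog \<in> borel_measurable borel"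
  unfolding neglog_def[abs_def] by measurable

lemma neglog_expneg [simp]: "neglog (expneg 1 x) = x"
  by (auto simp: neglog_def expneg_def less_top)

section \<open>Measurability of evaluations\<close>

lemma space_rm1 [simp]: "space rm1 = bfm"
  unfolding rm1_def by (rule space_measure_of) auto

lemma emeasure_rm1_measurable:
  assumes "A \<in> sets borel"
  shows "(\<lambda>m. emeasure m A) \<in> borel_measurable rm1"
proof (rule measurableI)
  fix B :: "ennreal set" assume "B \<in> sets borel"
  then show "(\<lambda>m. emeasure m A) -` B \<inter> space rm1 \<in> sets rm1"
    unfolding space_rm1 unfolding rm1_def using assms
    by (subst sets_measure_of) (auto intro!: sigma_sets.Basic)
qed simp

lemma space_rm_space: "space (rm_space d) = {m. \<forall>i\<in>{1..d}. m i \<in> bfm}"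
  unfolding rm_space_def by (rule space_measure_of) auto

lemma sets_rm_space: "sets (rm_space d) = sigma_sets {m. \<forall>i\<in>{1..d}. m i \<in> bfm}
     {{m. \<forall>i\<in>{1..d}. m i \<in> bfm} \<inter> {m. emeasure (m i) A \<in> B} | i A B.
        i \<in> {1..d} \<and> A \<in> sets borel \<and> B \<in> sets (borel :: ennreal measure)}"
  unfolding rm_space_def by (rule sets_measure_of) auto

lemma emeasure_rm_space_measurable:
  assumes "i \<in> {1..d}" "A \<in> sets borel"
  shows "(\<lambda>m. emeasure (m i) A) \<in> borel_measurable (rm_space d)"
proof (rule measurableI)
  fix B :: "ennreal set" assume B: "B \<in> sets borel"
  have "(\<lambda>m. emeasure (m i) A) -` B \<inter> space (rm_space d)
      = {m. \<forall>i\<in>{1..d}. m i \<in> bfm} \<inter> {m. emeasure (m i) A \<in> B}"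
    by (auto simp: space_rm_space)
  also have "\<dots> \<in> sets (rm_space d)"
    unfolding sets_rm_space using assms B by (blast intro: sigma_sets.Basic)
  finally show "(\<lambda>m. emeasure (m i) A) -` B \<inter> space (rm_space d) \<in> sets (rm_space d)" .
qed simp

text \<open>Conditioning on \<open>\<mu>0\<close> replaces each rate by its inner exponent. For
  fixed \<open>j\<close> the rates of the \<open>d\<close> coordinates add up, being applied to the
  same evaluation of \<open>\<mu>0\<close> at \<open>A j\<close>. Independence over the disjoint
  sets then splits the expectation.\<close>

lemma hCRV_joint_laplace:
  fixes \<mu> :: "'a \<Rightarrow> nat \<Rightarrow> ('x::polish_space) measure" and A :: "nat \<Rightarrow> 'x set"
    and lam :: "nat \<Rightarrow> nat \<Rightarrow> real"
  assumes h: "is_hCRV M d \<mu> \<rho> \<rho>0 P0" and \<rho>: "levy_measure \<rho>"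
    and A: "disjoint_family_on A {..<k}" "A ` {..<k} \<subseteq> sets borel" and lam: "\<And>i j. 0 \<le> lam i j"
  shows "(\<integral>\<omega>. (\<Prod>i\<in>{1..d}. \<Prod>j<k. expneg (lam i j) (emeasure (\<mu> \<omega> i) (A j))) \<partial>M)
       = (\<Prod>j<k. exp (- measure P0 (A j) * laplace_exp \<rho>0 (\<Sum>i\<in>{1..d}. laplace_exp \<rho> (lam i j))))"
proof -
  interpret prob_space M using h by (simp add: is_hCRV_def)
  obtain \<mu>0 where \<mu>0: "is_CRM M \<mu>0 \<rho>0 P0" and cond: "cond_CRMs M d \<mu> \<mu>0 \<rho>"
    using h by (auto simp: is_hCRV_def)
  have meas0: "\<mu>0 \<in> measurable M rm1" using \<mu>0 by (simp add: is_CRM_def)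
  define a where "a j = (\<Sum>i\<in>{1..d}. laplace_exp \<rho> (lam i j))" for j
  have a: "0 \<le> a j" for j unfolding a_def by (intro sum_nonneg laplace_exp_nonneg \<rho> lam)
  have one: "indicator bfm (\<mu>0 \<omega>) = (1::real)" if "\<omega> \<in> space M" for \<omega>
    using measurable_space[OF meas0 that] by simp
  \<comment> \<open>\<open>bfm\<close> is the whole space of \<open>rm1\<close>; as the test event
    it turns the conditional identity into an unconditional one.\<close>
  have bfm: "bfm \<in> sets rm1" using sets.top[of rm1] by simp
  \<comment> \<open>\<open>is_CRM\<close> speaks of infinite disjoint sequences, so the finite
    family is padded with empty sets.\<close>
  define A' where "A' j = (if j < k then A j else {})" for j
  have A': "disjoint_family A'" "range A' \<subseteq> sets borel"
    using A by (auto simp: A'_def disjoint_family_on_def)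
  have "indep_vars (\<lambda>_. borel) (\<lambda>j \<omega>. emeasure (\<mu>0 \<omega>) (A' j)) UNIV"
    using \<mu>0 A' unfolding is_CRM_def by (elim conjE allE[of _ A']) simp
  then have "indep_vars (\<lambda>_. borel) (\<lambda>j \<omega>. emeasure (\<mu>0 \<omega>) (A' j)) {..<k}"
    by (rule indep_vars_subset) simp
  then have indep: "indep_vars (\<lambda>_. borel) (\<lambda>j \<omega>. expneg (a j) (emeasure (\<mu>0 \<omega>) (A' j))) {..<k}"
    by (rule indep_vars_compose2[where Y="\<lambda>j. expneg (a j)"]) measurable
  have "(\<integral>\<omega>. (\<Prod>i\<in>{1..d}. \<Prod>j<k. expneg (lam i j) (emeasure (\<mu> \<omega> i) (A j))) \<partial>M)
      = (\<integral>\<omega>. indicator bfm (\<mu>0 \<omega>) * (\<Prod>i\<in>{1..d}. \<Prod>j<k. expneg (lam i j) (emeasure (\<mu> \<omega> i) (A j))) \<partial>M)"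
    by (intro Bochner_Integration.integral_cong) (auto simp: one)
  also have "\<dots> = (\<integral>\<omega>. indicator bfm (\<mu>0 \<omega>) *
      (\<Prod>i\<in>{1..d}. \<Prod>j<k. expneg (laplace_exp \<rho> (lam i j)) (emeasure (\<mu>0 \<omega>) (A j))) \<partial>M)"
    using cond A lam bfm unfolding cond_CRMs_def by blast
  also have "\<dots> = (\<integral>\<omega>. (\<Prod>j<k. expneg (a j) (emeasure (\<mu>0 \<omega>) (A' j))) \<partial>M)"
  proof (intro Bochner_Integration.integral_cong refl)
    fix \<omega> assume "\<omega> \<in> space M"
    have "(\<Prod>i\<in>{1..d}. \<Prod>j<k. expneg (laplace_exp \<rho> (lam i j)) (emeasure (\<mu>0 \<omega>) (A j)))
        = (\<Prod>j<k. \<Prod>i\<in>{1..d}. expneg (laplace_exp \<rho> (lam i j)) (emeasure (\<mu>0 \<omega>) (A j)))"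
      by (rule prod.swap)
    also have "\<dots> = (\<Prod>j<k. expneg (a j) (emeasure (\<mu>0 \<omega>) (A' j)))"
      by (intro prod.cong refl)
         (simp add: a_def A'_def expneg_sum_rate laplace_exp_nonneg \<rho> lam)
    finally show "indicator bfm (\<mu>0 \<omega>) *
        (\<Prod>i\<in>{1..d}. \<Prod>j<k. expneg (laplace_exp \<rho> (lam i j)) (emeasure (\<mu>0 \<omega>) (A j)))
      = (\<Prod>j<k. expneg (a j) (emeasure (\<mu>0 \<omega>) (A' j)))"
      using one[OF \<open>\<omega> \<in> space M\<close>] by simp
  qed
  also have "\<dots> = (\<Prod>j<k. \<integral>\<omega>. expneg (a j) (emeasure (\<mu>0 \<omega>) (A' j)) \<partial>M)"
  proof (rule indep_vars_lebesgue_integral[OF _ indep])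
    fix j assume "j \<in> {..<k}"
    have "(\<lambda>\<omega>. emeasure (\<mu>0 \<omega>) (A' j)) \<in> borel_measurable M"
      using A' by (intro measurable_compose[OF meas0 emeasure_rm1_measurable]) auto
    then have "(\<lambda>\<omega>. expneg (a j) (emeasure (\<mu>0 \<omega>) (A' j))) \<in> borel_measurable M"
      by (rule measurable_compose) measurable
    then show "integrable M (\<lambda>\<omega>. expneg (a j) (emeasure (\<mu>0 \<omega>) (A' j)))"
      using expneg_unit[OF a] by (intro integrable_const_bound[where B=1]) auto
  qed simp
  also have "\<dots> = (\<Prod>j<k. exp (- measure P0 (A j) * laplace_exp \<rho>0 (a j)))"
    using \<mu>0 A' a by (intro prod.cong refl) (auto simp: is_CRM_def A'_def)
  finally show ?thesis by (simp add: a_def)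
qed

text \<open>In the application \<open>S j\<close> lists the sets that contain atom \<open>j\<close>.
  Each pair \<open>(i, A)\<close> adds 1 to the rate of coordinate \<open>i\<close> on every atom of
  \<open>A\<close>, so a product over overlapping sets becomes one over atoms, with rates that count
  pairs.\<close>

lemma prod_list_expneg_atoms:
  fixes x :: "nat \<Rightarrow> nat \<Rightarrow> ennreal" and S :: "nat \<Rightarrow> 'c set" and F :: "'c \<Rightarrow> nat \<Rightarrow> ennreal"
  assumes F: "\<And>i A. (i, A) \<in> set vs \<Longrightarrow> i \<in> {1..d} \<and> F A i = (\<Sum>j | j < k \<and> A \<in> S j. x i j)"
  shows "(\<Prod>(i, A)\<leftarrow>vs. expneg 1 (F A i))
    = (\<Prod>i\<in>{1..d}. \<Prod>j<k. expneg (\<Sum>(i', A)\<leftarrow>vs. if i' = i \<and> A \<in> S j then 1 else 0) (x i j))"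
  using F
proof (induction vs)
  case Nil
  then show ?case by simp
next
  case (Cons q vs)
  obtain l A where q: "q = (l, A)" by (cases q)
  have l: "l \<in> {1..d}" and FA: "F A l = (\<Sum>j | j < k \<and> A \<in> S j. x l j)" using Cons.prems[of l A] q by auto
  let ?e = "\<lambda>i j. if l = i \<and> A \<in> S j then 1 else 0 :: real"
  let ?lam = "\<lambda>i j. \<Sum>(i', A)\<leftarrow>vs. if i' = i \<and> A \<in> S j then 1 else 0 :: real"
  have lam: "0 \<le> ?lam i j" for i j by (rule sum_list_nonneg) auto
  have "expneg 1 (F A l) = (\<Prod>j | j < k \<and> A \<in> S j. expneg 1 (x l j))"
    unfolding FA by (rule expneg_sum) simp
  also have "\<dots> = (\<Prod>j<k. expneg (?e l j) (x l j))"
    by (rule prod.mono_neutral_cong_left) auto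
  \<comment> \<open>Coordinates other than \<open>l\<close> receive rate 0, hence factors 1.\<close>
  also have "\<dots> = (\<Prod>i\<in>{1..d}. if i = l then \<Prod>j<k. expneg (?e i j) (x i j) else 1)"
    using l by (subst prod.delta) auto
  also have "\<dots> = (\<Prod>i\<in>{1..d}. \<Prod>j<k. expneg (?e i j) (x i j))"
    by (intro prod.cong refl) auto
  finally have e: "expneg 1 (F A l) = (\<Prod>i\<in>{1..d}. \<Prod>j<k. expneg (?e i j) (x i j))" .
  have "(\<Prod>(i, A)\<leftarrow>q # vs. expneg 1 (F A i)) = expneg 1 (F A l) * (\<Prod>(i, A)\<leftarrow>vs. expneg 1 (F A i))"
    by (simp add: q)
  also have "(\<Prod>(i, A)\<leftarrow>vs. expneg 1 (F A i)) = (\<Prod>i\<in>{1..d}. \<Prod>j<k. expneg (?lam i j) (x i j))"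
    by (rule Cons.IH) (use Cons.prems in auto)
  also have "expneg 1 (F A l) * \<dots> = (\<Prod>i\<in>{1..d}. \<Prod>j<k. expneg (?e i j + ?lam i j) (x i j))"
    unfolding e prod.distrib[symmetric] by (intro prod.cong refl expneg_add_rate[symmetric] lam) auto
  finally show ?case by (simp add: q)
qed

text \<open>Atoms are indexed by subfamilies: \<open>C j\<close> consists of the points that lie in
  the members of \<open>S j\<close> and in no other member of the family. Some atoms may be
  empty.\<close>

lemma finite_family_atoms:
  fixes \<F> :: "('x::topological_space) set set"
  assumes "finite \<F>" "\<F> \<subseteq> sets borel"
  obtains C :: "nat \<Rightarrow> 'x set" and k :: nat and S :: "nat \<Rightarrow> 'x set set"
  where "disjoint_family_on C {..<k}" "C ` {..<k} \<subseteq> sets borel"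
    "\<forall>A\<in>\<F>. A = (\<Union>j\<in>{j. j < k \<and> A \<in> S j}. C j)"
proof -
  obtain S where S: "bij_betw S {0..<card (Pow \<F>)} (Pow \<F>)"
    using ex_bij_betw_nat_finite[of "Pow \<F>"] assms(1) by auto
  define k where "k = card (Pow \<F>)"
  have S: "bij_betw S {..<k} (Pow \<F>)" using S by (simp add: k_def atLeast0LessThan)
  define C where "C j = {x. \<forall>A\<in>\<F>. x \<in> A \<longleftrightarrow> A \<in> S j}" for j
  show thesis
  proof (rule that[of C k S])
    show "disjoint_family_on C {..<k}"
      unfolding disjoint_family_on_def
    proof (intro ballI impI)
      fix i j assume ij: "i \<in> {..<k}" "j \<in> {..<k}" "i \<noteq> j"
      then have "S i \<noteq> S j" "S i \<subseteq> \<F>" "S j \<subseteq> \<F>"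
        using S by (auto simp: bij_betw_def inj_on_def)
      then obtain A where "A \<in> \<F>" "A \<in> S i \<longleftrightarrow> A \<notin> S j" by blast
      then show "C i \<inter> C j = {}" by (auto simp: C_def)
    qed
    show "C ` {..<k} \<subseteq> sets borel"
    proof safe
      fix j
      have "C j = {x\<in>space borel. \<forall>A\<in>\<F>. x \<in> A \<longleftrightarrow> A \<in> S j}" by (simp add: C_def)
      also have "\<dots> \<in> sets borel"
      proof (intro sets.sets_Collect_finite_All assms(1))
        fix A assume "A \<in> \<F>"
        then have [measurable]: "A \<in> sets borel" using assms(2) by blast
        show "{x\<in>space borel. x \<in> A \<longleftrightarrow> A \<in> S j} \<in> sets borel" by measurable
      qed
      finally show "C j \<in> sets borel" .
    qed
    show "\<forall>A\<in>\<F>. A = (\<Union>j\<in>{j. j < k \<and> A \<in> S j}. C j)"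
    proof
      fix A assume A: "A \<in> \<F>"
      have "x \<in> (\<Union>j\<in>{j. j < k \<and> A \<in> S j}. C j)" if "x \<in> A" for x
      proof -
        have "{A\<in>\<F>. x \<in> A} \<in> S ` {..<k}" unfolding bij_betw_imp_surj_on[OF S] by blast
        then obtain j where j: "j < k" "S j = {A\<in>\<F>. x \<in> A}" by (metis (no_types, lifting) imageE lessThan_iff)
        have "x \<in> C j" "A \<in> S j" using A that by (simp_all add: C_def j(2))
        then show ?thesis using j(1) by blast
      qed
      moreover have "C j \<subseteq> A" if "A \<in> S j" for j using A that by (auto simp: C_def)
      ultimately show "A = (\<Union>j\<in>{j. j < k \<and> A \<in> S j}. C j)" by blast
    qed
  qed
qed

text \<open>After passing to atoms, the joint transforms of the two models carry the same weights
  \<open>measure P0 (C j)\<close>, so equality of the composed exponents gives equality factor by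
  factor.\<close>

lemma hCRV_joint_moments_eq:
  fixes \<mu>1 :: "'a \<Rightarrow> nat \<Rightarrow> ('x::polish_space) measure" and \<mu>2 :: "'b \<Rightarrow> nat \<Rightarrow> 'x measure"
  assumes h1: "is_hCRV M1 d \<mu>1 \<rho>1 \<rho>01 P0" and h2: "is_hCRV M2 d \<mu>2 \<rho>2 \<rho>02 P0"
    and levy: "levy_measure \<rho>1" "levy_measure \<rho>2"
    and eq: "\<And>lam. (\<And>i. 0 \<le> lam i) \<Longrightarrow>
      laplace_exp \<rho>01 (\<Sum>i\<in>{1..d}. laplace_exp \<rho>1 (lam i)) = laplace_exp \<rho>02 (\<Sum>i\<in>{1..d}. laplace_exp \<rho>2 (lam i))"
    and vs: "set vs \<subseteq> {1..d} \<times> sets borel"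
  shows "(\<integral>\<omega>. (\<Prod>(i, A)\<leftarrow>vs. expneg 1 (emeasure (\<mu>1 \<omega> i) A)) \<partial>M1)
       = (\<integral>\<omega>. (\<Prod>(i, A)\<leftarrow>vs. expneg 1 (emeasure (\<mu>2 \<omega> i) A)) \<partial>M2)"
proof -
  have fin: "finite (snd ` set vs)" and sub: "snd ` set vs \<subseteq> sets borel" using vs by auto
  obtain C :: "nat \<Rightarrow> 'x set" and k :: nat and S :: "nat \<Rightarrow> 'x set set"
    where C: "disjoint_family_on C {..<k}" "C ` {..<k} \<subseteq> sets borel"
      and S: "\<forall>A\<in>snd ` set vs. A = (\<Union>j\<in>{j. j < k \<and> A \<in> S j}. C j)"
    by (rule finite_family_atoms[OF fin sub]) (rule that)
  define lam where "lam i j = (\<Sum>(i', A)\<leftarrow>vs. if i' = i \<and> A \<in> S j then 1 else 0 :: real)" for i j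
  have lam: "0 \<le> lam i j" for i j unfolding lam_def by (rule sum_list_nonneg) auto
  have expand: "(\<Prod>(i, A)\<leftarrow>vs. expneg 1 (emeasure (m i) A)) = (\<Prod>i\<in>{1..d}. \<Prod>j<k. expneg (lam i j) (emeasure (m i) (C j)))"
    if m: "m \<in> space (rm_space d)" for m :: "nat \<Rightarrow> 'x measure"
    unfolding lam_def
  proof (rule prod_list_expneg_atoms[where F="\<lambda>A i. emeasure (m i) A"])
    fix i A assume iA: "(i, A) \<in> set vs"
    then have i: "i \<in> {1..d}" using vs by auto
    then have sets: "sets (m i) = sets borel" using m by (auto simp: space_rm_space bfm_def)
    have "emeasure (m i) A = emeasure (m i) (\<Union>j\<in>{j. j < k \<and> A \<in> S j}. C j)"
      using bspec[OF S, of A] iA by (metis imageI snd_conv)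
    also have "\<dots> = (\<Sum>j | j < k \<and> A \<in> S j. emeasure (m i) (C j))"
      using C sets by (intro sum_emeasure[symmetric]) (auto simp: disjoint_family_on_def)
    finally show "i \<in> {1..d} \<and> emeasure (m i) A = (\<Sum>j | j < k \<and> A \<in> S j. emeasure (m i) (C j))"
      using i by simp
  qed
  have meas: "\<mu>1 \<in> measurable M1 (rm_space d)" "\<mu>2 \<in> measurable M2 (rm_space d)"
    using h1 h2 by (auto simp: is_hCRV_def)
  have "(\<integral>\<omega>. (\<Prod>(i, A)\<leftarrow>vs. expneg 1 (emeasure (\<mu>1 \<omega> i) A)) \<partial>M1)
      = (\<integral>\<omega>. (\<Prod>i\<in>{1..d}. \<Prod>j<k. expneg (lam i j) (emeasure (\<mu>1 \<omega> i) (C j))) \<partial>M1)"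
    by (intro Bochner_Integration.integral_cong refl expand measurable_space[OF meas(1)])
  also have "\<dots> = (\<integral>\<omega>. (\<Prod>i\<in>{1..d}. \<Prod>j<k. expneg (lam i j) (emeasure (\<mu>2 \<omega> i) (C j))) \<partial>M2)"
    unfolding hCRV_joint_laplace[OF h1 levy(1) C lam] hCRV_joint_laplace[OF h2 levy(2) C lam]
    by (subst eq[OF lam]) (rule refl)
  also have "\<dots> = (\<integral>\<omega>. (\<Prod>(i, A)\<leftarrow>vs. expneg 1 (emeasure (\<mu>2 \<omega> i) A)) \<partial>M2)"
    by (intro Bochner_Integration.integral_cong refl expand[symmetric] measurable_space[OF meas(2)])
  finally show ?thesis .
qed

lemma prod_list_indicator:
  "(\<Prod>(v, B)\<leftarrow>L. indicat_real B (f v)) = (if \<forall>(v, B)\<in>set L. f v \<in> B then 1 else 0)"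
  by (induction L) (auto split: split_indicator)

text \<open>Cylinder events with finitely many constraints generate the sigma-algebra and are closed
  under intersection. Their probabilities are expectations of products of indicators of the
  unit-interval variables given by \<open>expneg 1\<close>, and these are fixed by joint
  moments.\<close>

lemma eq_distI:
  fixes \<mu>1 :: "'a \<Rightarrow> nat \<Rightarrow> ('x::polish_space) measure" and \<mu>2 :: "'b \<Rightarrow> nat \<Rightarrow> 'x measure"
  assumes M: "prob_space M1" "prob_space M2"
    and meas: "\<mu>1 \<in> measurable M1 (rm_space d)" "\<mu>2 \<in> measurable M2 (rm_space d)"
    and moments: "\<And>vs. set vs \<subseteq> {1..d} \<times> sets borel \<Longrightarrow>
        (\<integral>\<omega>. (\<Prod>(i, A)\<leftarrow>vs. expneg 1 (emeasure (\<mu>1 \<omega> i) A)) \<partial>M1)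
      = (\<integral>\<omega>. (\<Prod>(i, A)\<leftarrow>vs. expneg 1 (emeasure (\<mu>2 \<omega> i) A)) \<partial>M2)"
  shows "eq_dist d M1 \<mu>1 M2 \<mu>2"
proof -
  interpret M1: prob_space M1 by fact
  interpret M2: prob_space M2 by fact
  define V where "V = {1..d} \<times> sets (borel :: 'x measure)"
  let ?\<Omega> = "{m :: nat \<Rightarrow> 'x measure. \<forall>i\<in>{1..d}. m i \<in> bfm}"
  define cyl where "cyl L = {m \<in> ?\<Omega>. \<forall>((i, A), B)\<in>set L. emeasure (m i) A \<in> B}"
    for L :: "((nat \<times> 'x set) \<times> ennreal set) list"
  define E where "E = cyl ` {L. set L \<subseteq> V \<times> sets borel}"
  have evals: "(\<lambda>m. emeasure (m i) A) \<in> borel_measurable (rm_space d)" if "(i, A) \<in> V" for i A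
    using that by (intro emeasure_rm_space_measurable) (auto simp: V_def)
  have cyl_sets: "cyl L \<in> sets (rm_space d)" if "set L \<subseteq> V \<times> sets borel" for L
    using that
  proof (induction L)
    case Nil
    then show ?case using sets.top[of "rm_space d"] by (simp add: cyl_def space_rm_space)
  next
    case (Cons q L)
    obtain i A B where q: "q = ((i, A), B)" by (cases q) auto
    have "cyl (q # L) = cyl L \<inter> ((\<lambda>m. emeasure (m i) A) -` B \<inter> space (rm_space d))"
      by (auto simp: cyl_def q space_rm_space)
    then show ?case using Cons q by (auto intro!: sets.Int measurable_sets[OF evals])
  qed
  have sigma: "sets (rm_space d) = sigma_sets ?\<Omega> E"
  proof
    show "sets (rm_space d) \<subseteq> sigma_sets ?\<Omega> E"
      unfolding sets_rm_space
    proof (rule sigma_sets_mono, safe)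
      fix i :: nat and A :: "'x set" and B :: "ennreal set"
      assume *: "i \<in> {1..d}" "A \<in> sets borel" "B \<in> sets borel"
      have "?\<Omega> \<inter> {m. emeasure (m i) A \<in> B} = cyl [((i, A), B)]" by (auto simp: cyl_def)
      then show "?\<Omega> \<inter> {m. emeasure (m i) A \<in> B} \<in> sigma_sets ?\<Omega> E"
        using * by (auto simp: E_def V_def intro!: sigma_sets.Basic imageI)
    qed
    have "sigma_sets ?\<Omega> E \<subseteq> sigma_sets ?\<Omega> (sets (rm_space d))"
      using cyl_sets by (intro sigma_sets_mono') (auto simp: E_def)
    then show "sigma_sets ?\<Omega> E \<subseteq> sets (rm_space d)"
      using sets.sigma_sets_eq[of "rm_space d :: (nat \<Rightarrow> 'x measure) measure"] by (simp add: space_rm_space)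
  qed
  \<comment> \<open>Since \<open>neglog\<close> undoes \<open>expneg 1\<close>, constraints on
    evaluations become constraints on unit-interval variables, with \<open>B\<close> replaced by its
    preimage under \<open>neglog\<close>. The empty moment product is kept to fit
    \<open>integral_indicators_eq_if_joint_moments_eq\<close>.\<close>
  have cyl_prob: "measure (distr K (rm_space d) \<mu>) (cyl L) =
      (\<integral>\<omega>. (\<Prod>(v, B)\<leftarrow>map (\<lambda>(v, B). (v, neglog -` B)) L. indicator B (expneg 1 (emeasure (\<mu> \<omega> (fst v)) (snd v)))) *
           (\<Prod>v\<leftarrow>[]. expneg 1 (emeasure (\<mu> \<omega> (fst v)) (snd v))) \<partial>K)"
    if \<mu>: "\<mu> \<in> measurable K (rm_space d)" and L: "set L \<subseteq> V \<times> sets borel"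
    for K :: "'k measure" and \<mu> L
  proof -
    have "measure (distr K (rm_space d) \<mu>) (cyl L) = measure K (\<mu> -` cyl L \<inter> space K)"
      using \<mu> cyl_sets[OF L] by (rule measure_distr)
    also have "\<dots> = (\<integral>\<omega>. indicator (\<mu> -` cyl L \<inter> space K) \<omega> \<partial>K)"
      by simp
    also have "\<dots> = (\<integral>\<omega>. (\<Prod>(v, B)\<leftarrow>map (\<lambda>(v, B). (v, neglog -` B)) L. indicator B (expneg 1 (emeasure (\<mu> \<omega> (fst v)) (snd v)))) *
           (\<Prod>v\<leftarrow>[]. expneg 1 (emeasure (\<mu> \<omega> (fst v)) (snd v))) \<partial>K)"
    proof (intro Bochner_Integration.integral_cong refl)
      fix \<omega> assume "\<omega> \<in> space K"
      then have "\<mu> \<omega> \<in> ?\<Omega>" using measurable_space[OF \<mu>] by (simp add: space_rm_space)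
      then have "\<omega> \<in> \<mu> -` cyl L \<inter> space K \<longleftrightarrow> (\<forall>((i, A), B)\<in>set L. emeasure (\<mu> \<omega> i) A \<in> B)"
        using \<open>\<omega> \<in> space K\<close> by (auto simp: cyl_def)
      then show "indicator (\<mu> -` cyl L \<inter> space K) \<omega> =
        (\<Prod>(v, B)\<leftarrow>map (\<lambda>(v, B). (v, neglog -` B)) L. indicator B (expneg 1 (emeasure (\<mu> \<omega> (fst v)) (snd v)))) *
           (\<Prod>v\<leftarrow>[]. expneg 1 (emeasure (\<mu> \<omega> (fst v)) (snd v)))"
        unfolding prod_list_indicator by (auto simp: indicator_def split_beta)
    qed
    finally show ?thesis .
  qed
  have "emeasure (distr M1 (rm_space d) \<mu>1) X = emeasure (distr M2 (rm_space d) \<mu>2) X" if "X \<in> E" for X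
  proof -
    obtain L where X: "X = cyl L" and L: "set L \<subseteq> V \<times> sets borel" using \<open>X \<in> E\<close> by (auto simp: E_def)
    have "measure (distr M1 (rm_space d) \<mu>1) X = measure (distr M2 (rm_space d) \<mu>2) X"
      unfolding X cyl_prob[OF meas(1) L] cyl_prob[OF meas(2) L]
    proof (rule integral_indicators_eq_if_joint_moments_eq[OF M, where V=V])
      show "set (map (\<lambda>(v, B). (v, neglog -` B)) L) \<subseteq> V \<times> sets borel"
        using L measurable_sets[OF neglog_measurable] by auto
      show "(\<integral>\<omega>. (\<Prod>v\<leftarrow>vs. expneg 1 (emeasure (\<mu>1 \<omega> (fst v)) (snd v))) \<partial>M1)
          = (\<integral>\<omega>. (\<Prod>v\<leftarrow>vs. expneg 1 (emeasure (\<mu>2 \<omega> (fst v)) (snd v))) \<partial>M2)" if "set vs \<subseteq> V" for vs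
        using moments[of vs] that by (simp add: V_def case_prod_unfold)
      show "(\<lambda>\<omega>. expneg 1 (emeasure (\<mu>1 \<omega> (fst v)) (snd v))) \<in> borel_measurable M1" if "v \<in> V" for v
        using that by (intro measurable_compose[OF _ expneg_measurable] measurable_compose[OF meas(1) evals]) auto
      show "(\<lambda>\<omega>. expneg 1 (emeasure (\<mu>2 \<omega> (fst v)) (snd v))) \<in> borel_measurable M2" if "v \<in> V" for v
        using that by (intro measurable_compose[OF _ expneg_measurable] measurable_compose[OF meas(2) evals]) auto
    qed (auto intro!: expneg_unit[unfolded atLeastAtMost_iff, THEN conjunct1] expneg_unit[unfolded atLeastAtMost_iff, THEN conjunct2])
    then show ?thesis
      using M1.prob_space_distr[OF meas(1)] M2.prob_space_distr[OF meas(2)]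
      by (simp add: finite_measure.emeasure_eq_measure prob_space_def)
  qed
  then have "distr M1 (rm_space d) \<mu>1 = distr M2 (rm_space d) \<mu>2"
  proof (intro measure_eqI_generator_eq[where \<Omega>="?\<Omega>" and E=E and A="\<lambda>_. ?\<Omega>"])
    show "Int_stable E"
    proof (rule Int_stableI)
      fix a b assume "a \<in> E" "b \<in> E"
      then obtain L L' where "a = cyl L" "b = cyl L'" "set L \<subseteq> V \<times> sets borel" "set L' \<subseteq> V \<times> sets borel"
        by (auto simp: E_def)
      moreover have "cyl L \<inter> cyl L' = cyl (L @ L')" unfolding cyl_def set_append ball_Un by blast
      ultimately show "a \<inter> b \<in> E" by (auto simp: E_def)
    qed
    show "E \<subseteq> Pow ?\<Omega>" by (auto simp: E_def cyl_def)
    have "cyl [] \<in> E" by (auto simp: E_def)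
    then show "range (\<lambda>_::nat. ?\<Omega>) \<subseteq> E" by (simp add: cyl_def)
    show "emeasure (distr M1 (rm_space d) \<mu>1) ?\<Omega> \<noteq> \<infinity>"
      using finite_measure.emeasure_finite[OF prob_space.finite_measure[OF M1.prob_space_distr[OF meas(1)]]] by simp
  qed (use sigma in auto)
  then show ?thesis by (simp add: eq_dist_def)
qed

lemma hCRV_eq_distI:
  fixes \<mu>1 :: "'a \<Rightarrow> nat \<Rightarrow> ('x::polish_space) measure" and \<mu>2 :: "'b \<Rightarrow> nat \<Rightarrow> 'x measure"
  assumes h1: "is_hCRV M1 d \<mu>1 \<rho>1 \<rho>01 P0" and h2: "is_hCRV M2 d \<mu>2 \<rho>2 \<rho>02 P0"
    and levy: "levy_measure \<rho>1" "levy_measure \<rho>2"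
    and eq: "\<And>lam. (\<And>i. 0 \<le> lam i) \<Longrightarrow>
      laplace_exp \<rho>01 (\<Sum>i\<in>{1..d}. laplace_exp \<rho>1 (lam i)) = laplace_exp \<rho>02 (\<Sum>i\<in>{1..d}. laplace_exp \<rho>2 (lam i))"
  shows "eq_dist d M1 \<mu>1 M2 \<mu>2"
  using h1 h2 by (intro eq_distI hCRV_joint_moments_eq[OF assms]) (auto simp: is_hCRV_def)

lemma hCRV_eq_distD:
  fixes \<mu>1 :: "'a \<Rightarrow> nat \<Rightarrow> ('x::polish_space) measure" and \<mu>2 :: "'b \<Rightarrow> nat \<Rightarrow> 'x measure"
  assumes h1: "is_hCRV M1 d \<mu>1 \<rho>1 \<rho>01 P01" and h2: "is_hCRV M2 d \<mu>2 \<rho>2 \<rho>02 P02"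
    and levy: "levy_measure \<rho>1" "levy_measure \<rho>2"
    and eq: "eq_dist d M1 \<mu>1 M2 \<mu>2" and A: "A \<in> sets borel" and lam: "\<And>i. 0 \<le> lam i"
  shows "measure P01 A * laplace_exp \<rho>01 (\<Sum>i\<in>{1..d}. laplace_exp \<rho>1 (lam i))
       = measure P02 A * laplace_exp \<rho>02 (\<Sum>i\<in>{1..d}. laplace_exp \<rho>2 (lam i))"
proof -
  have meas: "\<mu>1 \<in> measurable M1 (rm_space d)" "\<mu>2 \<in> measurable M2 (rm_space d)"
    using h1 h2 by (auto simp: is_hCRV_def)
  \<comment> \<open>The inner product has a single factor, so that \<open>hCRV_joint_laplace\<close>
    applies with \<open>k = 1\<close>.\<close>
  let ?f = "\<lambda>m :: nat \<Rightarrow> 'x measure. \<Prod>i\<in>{1..d}. \<Prod>j<Suc 0. expneg (lam i) (emeasure (m i) A)"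
  have f: "?f \<in> borel_measurable (rm_space d)"
    by (intro borel_measurable_prod measurable_compose[OF emeasure_rm_space_measurable expneg_measurable] A)
  have "(\<integral>\<omega>. ?f (\<mu>1 \<omega>) \<partial>M1) = (\<integral>m. ?f m \<partial>distr M1 (rm_space d) \<mu>1)"
    by (rule integral_distr[OF meas(1) f, symmetric])
  also have "\<dots> = (\<integral>m. ?f m \<partial>distr M2 (rm_space d) \<mu>2)" using eq by (simp only: eq_dist_def)
  also have "\<dots> = (\<integral>\<omega>. ?f (\<mu>2 \<omega>) \<partial>M2)"
    by (rule integral_distr[OF meas(2) f])
  finally show ?thesis
    using hCRV_joint_laplace[OF h1 levy(1), of "\<lambda>_. A" "Suc 0" "\<lambda>i _. lam i"]
      hCRV_joint_laplace[OF h2 levy(2), of "\<lambda>_. A" "Suc 0" "\<lambda>i _. lam i"] A lam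
    by (auto simp: disjoint_family_on_def image_subset_iff)
qed

section \<open>Identification of the parameters\<close>

text \<open>Nonnegativity and additivity make \<open>g\<close> monotone, so a grid of step
  \<open>x / N\<close> gives the value at \<open>L\<close> up to one step. The resulting error in
  the claim is at most \<open>x * g x / N\<close> for every \<open>N\<close>. The product form also
  covers \<open>L = 0\<close>.\<close>

lemma additive_nonneg_imp_linear:
  fixes g :: "real \<Rightarrow> real"
  assumes nonneg: "\<And>x. 0 \<le> x \<Longrightarrow> x \<le> L \<Longrightarrow> 0 \<le> g x"
    and add: "\<And>x y. 0 \<le> x \<Longrightarrow> 0 \<le> y \<Longrightarrow> x + y \<le> L \<Longrightarrow> g (x + y) = g x + g y"
    and x: "0 \<le> x" "x \<le> L"
  shows "L * g x = x * g L"
proof (cases "x = 0")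
  case True
  have "g 0 = 0" using add[of 0 0] x by simp
  then show ?thesis using True by simp
next
  case False
  then have "0 < x" using x by simp
  define D where "D = \<bar>L * g x - x * g L\<bar>"
  have bound: "real (Suc n) * D \<le> x * g x" for n
  proof -
    define N where "N = real (Suc n)"
    have "0 < N" by (simp add: N_def)
    define \<delta> where "\<delta> = x / N"
    have \<delta>: "0 < \<delta>" "x = N * \<delta>" using \<open>0 < x\<close> \<open>0 < N\<close> by (auto simp: \<delta>_def)
    have mult: "g (real k * \<delta>) = real k * g \<delta>" if "real k * \<delta> \<le> L" for k
      using that
    proof (induction k)
      case 0
      then show ?case using add[of 0 0] x by simp
    next
      case (Suc k)
      have "real k * \<delta> \<le> real (Suc k) * \<delta>" using \<delta> by (simp add: algebra_simps)
      then show ?case using Suc add[of "real k * \<delta>" \<delta>] \<delta> by (simp add: algebra_simps)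
    qed
    \<comment> \<open>\<open>k\<close> is the number of full steps in \<open>L\<close>; the
      remainder \<open>r\<close> is at most one step.\<close>
    define k where "k = nat \<lfloor>L / \<delta>\<rfloor>"
    have "0 \<le> L / \<delta>" using x \<delta> by simp
    then have "real k \<le> L / \<delta>" "L / \<delta> < real k + 1" by (auto simp: k_def)
    then have k: "real k * \<delta> \<le> L" "L < (real k + 1) * \<delta>" using \<delta> by (auto simp: field_simps)
    have "1 * \<delta> \<le> N * \<delta>" using \<delta> by (intro mult_right_mono) (auto simp: N_def)
    then have "\<delta> \<le> L" using x \<delta> by linarith
    define r where "r = L - real k * \<delta>"
    have r: "0 \<le> r" "r \<le> \<delta>" "r \<le> L" using k \<open>\<delta> \<le> L\<close> by (auto simp: r_def algebra_simps)
    have gr: "0 \<le> g r" "g r \<le> g \<delta>"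
      using nonneg[of r] nonneg[of "\<delta> - r"] add[of r "\<delta> - r"] r \<open>\<delta> \<le> L\<close> by auto
    have gL: "g L = real k * g \<delta> + g r"
      using add[of "real k * \<delta>" r] mult[OF k(1)] k r \<delta> by (simp add: r_def)
    have gx: "g x = N * g \<delta>" using mult[of "Suc n"] x(2) unfolding \<delta>(2) N_def by blast
    \<comment> \<open>With \<open>L = real k * \<delta> + r\<close> the terms in \<open>k\<close>
      cancel, and only the contribution of the remainder is left.\<close>
    have "L * g x - x * g L = N * (r * g \<delta> - \<delta> * g r)"
      unfolding gx gL unfolding \<delta>(2) r_def by (simp add: algebra_simps)
    moreover have "\<bar>r * g \<delta> - \<delta> * g r\<bar> \<le> \<delta> * g \<delta>"
    proof -
      have "0 \<le> r * g \<delta>" "0 \<le> \<delta> * g r" using r gr \<delta> by auto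
      moreover have "r * g \<delta> \<le> \<delta> * g \<delta>" "\<delta> * g r \<le> \<delta> * g \<delta>"
        using r gr \<delta> by (auto intro: mult_right_mono mult_left_mono)
      ultimately show ?thesis by linarith
    qed
    ultimately have "D \<le> N * (\<delta> * g \<delta>)" using \<open>0 < N\<close> by (simp add: D_def abs_mult)
    then have "N * D \<le> N * (N * (\<delta> * g \<delta>))" using \<open>0 < N\<close> by (intro mult_left_mono) auto
    also have "\<dots> = x * g x" unfolding gx unfolding \<delta>(2) by simp
    finally show ?thesis by (simp add: N_def)
  qed
  have "D = 0"
  proof (rule ccontr)
    assume "D \<noteq> 0"
    then have "D > 0" by (simp add: D_def)
    then obtain n where "x * g x < real n * D" using ex_less_of_nat_mult by blast
    also have "real n * D \<le> real (Suc n) * D" using \<open>D > 0\<close> by simp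
    finally show False using bound[of n] by simp
  qed
  then show ?thesis by (simp add: D_def)
qed

text \<open>\<open>p\<close> composed with the inverse of \<open>f\<close> is additive on the
  interval from 0 to \<open>f b\<close>, where the intermediate value theorem provides preimages.
  The range of \<open>f\<close> may be bounded, so Cauchy's equation is solved on that interval and
  not on the half-line.\<close>

lemma proportional_if_respects_sums:
  fixes f p :: "real \<Rightarrow> real"
  assumes f: "continuous_on {0..} f" "f 0 = 0" "\<And>a b. 0 \<le> a \<Longrightarrow> a < b \<Longrightarrow> f a < f b"
    and p: "\<And>a. 0 \<le> a \<Longrightarrow> 0 \<le> p a"
    and sums: "\<And>a b e. 0 \<le> a \<Longrightarrow> 0 \<le> b \<Longrightarrow> 0 \<le> e \<Longrightarrow> f a + f b = f e \<Longrightarrow> p a + p b = p e"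
    and ab: "0 \<le> a" "a \<le> b"
  shows "f b * p a = f a * p b"
proof -
  \<comment> \<open>By strict monotonicity the choice returns the inverse of \<open>f\<close> on its
    range.\<close>
  define g where "g x = p (SOME u. 0 \<le> u \<and> f u = x)" for x
  have mono: "f u \<le> f v" if "0 \<le> u" "u \<le> v" for u v using f(3)[of u v] that by (cases "u = v") auto
  have g: "g (f u) = p u" if "0 \<le> u" for u
  proof -
    have "(SOME v. 0 \<le> v \<and> f v = f u) = u"
      using that f(3) by (intro some_equality) (auto, metis linorder_neqE_linordered_idom order_less_irrefl)
    then show ?thesis by (simp add: g_def)
  qed
  have preimage: "\<exists>u\<ge>0. f u = x" if "0 \<le> x" "x \<le> f b" for x
    using IVT'[of f 0 x b] that f(2) ab continuous_on_subset[OF f(1), of "{0..b}"] by auto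
  have "f b * g (f a) = f a * g (f b)"
  proof (rule additive_nonneg_imp_linear)
    show "0 \<le> g x" if x: "0 \<le> x" "x \<le> f b" for x
    proof -
      obtain u where "u \<ge> 0" "f u = x" using preimage[OF x] by blast
      then show ?thesis using g[of u] p[of u] by simp
    qed
    show "g (x + y) = g x + g y" if xy: "0 \<le> x" "0 \<le> y" "x + y \<le> f b" for x y
    proof -
      obtain u where u: "u \<ge> 0" "f u = x" using preimage[of x] xy by auto
      obtain v where v: "v \<ge> 0" "f v = y" using preimage[of y] xy by auto
      obtain w where w: "w \<ge> 0" "f w = x + y" using preimage[of "x + y"] xy by auto
      show ?thesis using sums[of u v w] u v w g[of u] g[of v] g[of w] by simp
    qed
    show "0 \<le> f a" "f a \<le> f b" using mono[of 0 a] mono[of a b] f(2) ab by auto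
  qed
  then show ?thesis using g ab by simp
qed

section \<open>Scaling of Levy measures and of their densities\<close>

lemma levy_measureI:
  assumes sets: "sets \<rho> = sets borel" and null: "emeasure \<rho> {..0} = 0"
    and tail: "\<And>\<epsilon>. 0 < \<epsilon> \<Longrightarrow> emeasure \<rho> {\<epsilon><..} < \<infinity>"
    and small: "\<And>\<epsilon>. 0 < \<epsilon> \<Longrightarrow> (\<integral>\<^sup>+ s. ennreal s * indicator {0<..<\<epsilon>} s \<partial>\<rho>) < \<infinity>"
  shows "levy_measure \<rho>"
proof -
  have "sigma_finite_measure \<rho>"
  proof
    \<comment> \<open>\<open>{..0}\<close> is null and the tails have finite mass; together they
      cover the line, which yields sigma-finiteness.\<close>
    define \<A> where "\<A> = insert {..0::real} (range (\<lambda>n. {1 / real (Suc n)<..}))"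
    have union: "\<Union>\<A> = space \<rho>"
    proof -
      have "x \<in> \<Union>\<A>" for x
      proof (cases "0 < x")
        case True
        then obtain n where "1 / real (Suc n) < x" using reals_Archimedean[of x] by (auto simp: inverse_eq_divide)
        then show ?thesis unfolding \<A>_def by blast
      qed (simp add: \<A>_def)
      then show ?thesis using sets_eq_imp_space_eq[OF sets] by auto
    qed
    have fin: "\<forall>a\<in>\<A>. emeasure \<rho> a \<noteq> \<infinity>"
    proof
      fix a assume "a \<in> \<A>"
      then consider "a = {..0}" | n where "a = {1 / real (Suc n)<..}" by (auto simp: \<A>_def)
      then show "emeasure \<rho> a \<noteq> \<infinity>"
      proof cases
        case 1
        then show ?thesis using null by simp
      next
        case (2 n)
        then show ?thesis using tail[of "1 / real (Suc n)"] by (simp add: less_top)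
      qed
    qed
    have "countable \<A>" "\<A> \<subseteq> sets \<rho>" by (auto simp: \<A>_def sets)
    with union fin show "\<exists>A. countable A \<and> A \<subseteq> sets \<rho> \<and> \<Union>A = space \<rho> \<and> (\<forall>a\<in>A. emeasure \<rho> a \<noteq> \<infinity>)"
      by (intro exI[of _ \<A>] conjI)
  qed
  then show ?thesis using assms by (simp add: levy_measure_def)
qed

lemma levy_measure_scale:
  assumes \<rho>: "levy_measure \<rho>" and c: "0 < c"
  shows "levy_measure (scale_measure (ennreal c) \<rho>)"
    and "laplace_exp (scale_measure (ennreal c) \<rho>) t = c * laplace_exp \<rho> t"
proof -
  have sets[measurable_cong]: "sets \<rho> = sets borel" using \<rho> by (simp add: levy_measure_def)
  show "levy_measure (scale_measure (ennreal c) \<rho>)"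
  proof (rule levy_measureI)
    fix \<epsilon> :: real assume "0 < \<epsilon>"
    then have fin: "emeasure \<rho> {\<epsilon><..} < \<infinity>" "(\<integral>\<^sup>+ s. ennreal s * indicator {0<..<\<epsilon>} s \<partial>\<rho>) < \<infinity>"
      using \<rho> by (auto simp: levy_measure_def)
    show "emeasure (scale_measure (ennreal c) \<rho>) {\<epsilon><..} < \<infinity>"
      using fin by (simp add: ennreal_mult_less_top)
    show "(\<integral>\<^sup>+ s. ennreal s * indicator {0<..<\<epsilon>} s \<partial>scale_measure (ennreal c) \<rho>) < \<infinity>"
      using fin by (subst nn_integral_scale_measure) (auto simp: ennreal_mult_less_top)
  qed (use \<rho> in \<open>auto simp: levy_measure_def\<close>)
  have "scale_measure (ennreal c) \<rho> = density \<rho> (\<lambda>_. ennreal c)"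
    by (rule measure_eqI) (auto simp: emeasure_density nn_integral_cmult_indicator)
  then show "laplace_exp (scale_measure (ennreal c) \<rho>) t = c * laplace_exp \<rho> t"
    unfolding laplace_exp_def using c by (simp add: integral_density)
qed

lemma levy_measure_distr:
  assumes \<rho>: "levy_measure \<rho>" and c: "0 < c"
  shows "levy_measure (distr \<rho> borel (\<lambda>s. s / c))"
    and "laplace_exp (distr \<rho> borel (\<lambda>s. s / c)) t = laplace_exp \<rho> (t / c)"
proof -
  have sets[measurable_cong]: "sets \<rho> = sets borel" using \<rho> by (simp add: levy_measure_def)
  have space: "space \<rho> = UNIV" using sets_eq_imp_space_eq[OF sets] by simp
  show "levy_measure (distr \<rho> borel (\<lambda>s. s / c))"
  proof (rule levy_measureI)
    have "(\<lambda>s. s / c) -` {..0} = {..0}" using c by (auto simp: divide_le_0_iff)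
    then show "emeasure (distr \<rho> borel (\<lambda>s. s / c)) {..0} = 0"
      using \<rho> space by (subst emeasure_distr) (auto simp: levy_measure_def)
    fix \<epsilon> :: real assume "0 < \<epsilon>"
    then have "0 < c * \<epsilon>" using c by simp
    then have fin: "emeasure \<rho> {c * \<epsilon><..} < \<infinity>" "(\<integral>\<^sup>+ s. ennreal s * indicator {0<..<c * \<epsilon>} s \<partial>\<rho>) < \<infinity>"
      using \<rho> by (auto simp: levy_measure_def)
    have "(\<lambda>s. s / c) -` {\<epsilon><..} = {c * \<epsilon><..}" using c by (auto simp: field_simps)
    then show "emeasure (distr \<rho> borel (\<lambda>s. s / c)) {\<epsilon><..} < \<infinity>"
      using fin space by (subst emeasure_distr) auto
    have "(\<integral>\<^sup>+ s. ennreal s * indicator {0<..<\<epsilon>} s \<partial>distr \<rho> borel (\<lambda>s. s / c))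
        = (\<integral>\<^sup>+ s. ennreal (s / c) * indicator {0<..<\<epsilon>} (s / c) \<partial>\<rho>)"
      by (subst nn_integral_distr) auto
    also have "\<dots> = (\<integral>\<^sup>+ s. ennreal (1 / c) * (ennreal s * indicator {0<..<c * \<epsilon>} s) \<partial>\<rho>)"
      using c by (intro nn_integral_cong)
        (auto split: split_indicator simp: ennreal_mult[symmetric] field_simps)
    also have "\<dots> = ennreal (1 / c) * (\<integral>\<^sup>+ s. ennreal s * indicator {0<..<c * \<epsilon>} s \<partial>\<rho>)"
      by (rule nn_integral_cmult) measurable
    finally show "(\<integral>\<^sup>+ s. ennreal s * indicator {0<..<\<epsilon>} s \<partial>distr \<rho> borel (\<lambda>s. s / c)) < \<infinity>"
      using fin by (simp add: ennreal_mult_less_top)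
  qed simp
  show "laplace_exp (distr \<rho> borel (\<lambda>s. s / c)) t = laplace_exp \<rho> (t / c)"
    unfolding laplace_exp_def by (subst integral_distr) auto
qed

text \<open>The factor \<open>c\<close> is the Jacobian of the substitution of \<open>c * s\<close>
  for \<open>s\<close>.\<close>

lemma distr_density_lborel_divide:
  fixes f :: "real \<Rightarrow> real"
  assumes [measurable]: "f \<in> borel_measurable borel" and c: "0 < c"
  shows "distr (density lborel (\<lambda>s. ennreal (f s))) borel (\<lambda>s. s / c) = density lborel (\<lambda>s. ennreal (c * f (c * s)))"
proof (rule measure_eqI)
  fix A assume "A \<in> sets (distr (density lborel (\<lambda>s. ennreal (f s))) borel (\<lambda>s. s / c))"
  then have [measurable]: "A \<in> sets borel" by simp
  have "emeasure (distr (density lborel (\<lambda>s. ennreal (f s))) borel (\<lambda>s. s / c)) A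
      = (\<integral>\<^sup>+ s. indicator A s \<partial>distr (density lborel (\<lambda>s. ennreal (f s))) borel (\<lambda>s. s / c))"
    by simp
  also have "\<dots> = (\<integral>\<^sup>+ s. indicator A (s / c) \<partial>density lborel (\<lambda>s. ennreal (f s)))"
    by (rule nn_integral_distr) measurable
  also have "\<dots> = (\<integral>\<^sup>+ s. ennreal (f s) * indicator A (s / c) \<partial>lborel)"
    by (rule nn_integral_density) measurable
  also have "\<dots> = ennreal c * (\<integral>\<^sup>+ s. ennreal (f (c * s)) * indicator A s \<partial>lborel)"
    using c by (subst nn_integral_real_affine[where c=c and t=0]) auto
  also have "\<dots> = (\<integral>\<^sup>+ s. ennreal (c * f (c * s)) * indicator A s \<partial>lborel)"
    using c by (subst nn_integral_cmult[symmetric]) (auto simp: ennreal_mult' mult.assoc)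
  finally show "emeasure (distr (density lborel (\<lambda>s. ennreal (f s))) borel (\<lambda>s. s / c)) A
      = emeasure (density lborel (\<lambda>s. ennreal (c * f (c * s)))) A"
    by (simp add: emeasure_density)
qed simp

lemma scale_density_lborel:
  fixes f :: "real \<Rightarrow> real"
  assumes [measurable]: "f \<in> borel_measurable borel" and c: "0 < c"
  shows "scale_measure (ennreal c) (density lborel (\<lambda>s. ennreal (f s))) = density lborel (\<lambda>s. ennreal (c * f s))"
proof (rule measure_eqI)
  fix A assume "A \<in> sets (scale_measure (ennreal c) (density lborel (\<lambda>s. ennreal (f s))))"
  then have [measurable]: "A \<in> sets borel" by simp
  show "emeasure (scale_measure (ennreal c) (density lborel (\<lambda>s. ennreal (f s)))) A
      = emeasure (density lborel (\<lambda>s. ennreal (c * f s))) A"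
    using c by (simp add: emeasure_density nn_integral_cmult[symmetric] ennreal_mult' mult.assoc)
qed simp

text \<open>A measure fixes its density only up to null sets. A Levy measure leaves
  \<open>{..0}\<close> without mass, so both densities vanish almost everywhere there and only
  \<open>s > 0\<close> remains to be compared.\<close>

lemma levy_density_eq_iff:
  fixes f g :: "real \<Rightarrow> real"
  assumes [measurable]: "f \<in> borel_measurable borel" "g \<in> borel_measurable borel"
    and nonneg: "\<And>s. 0 \<le> f s" "\<And>s. 0 \<le> g s"
    and levy: "levy_measure (density lborel (\<lambda>s. ennreal (f s)))" "levy_measure (density lborel (\<lambda>s. ennreal (g s)))"
  shows "density lborel (\<lambda>s. ennreal (f s)) = density lborel (\<lambda>s. ennreal (g s))
    \<longleftrightarrow> (AE s in lborel. 0 < s \<longrightarrow> f s = g s)"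
proof -
  have "AE s in lborel. 0 < f s \<longrightarrow> 0 < s" "AE s in lborel. 0 < g s \<longrightarrow> 0 < s"
    using levy_pos[OF levy(1)] levy_pos[OF levy(2)] by (simp_all add: AE_density)
  then have "AE s in lborel. f s = g s \<longleftrightarrow> (0 < s \<longrightarrow> f s = g s)"
  proof eventually_elim
    case (elim s)
    then show ?case using nonneg[of s] by (metis order_le_less)
  qed
  then have "(AE s in lborel. f s = g s) \<longleftrightarrow> (AE s in lborel. 0 < s \<longrightarrow> f s = g s)"
    by (rule eventually_subst)
  then show ?thesis using nonneg by (subst sigma_finite_measure.density_unique_iff[OF sigma_finite_lborel]) auto
qed

text \<open>The exponent of \<open>\<rho>02\<close> is injective and can be stripped from
  \<open>eq\<close>: whenever two values of the first inner exponent add up to a third, so do the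
  corresponding values of the second. Such maps are proportional.\<close>

lemma laplace_exponents_proportional:
  assumes levy: "levy_measure \<rho>1" "levy_measure \<rho>2" "levy_measure \<rho>02"
    and nontriv: "\<rho>1 \<noteq> null_measure borel" "\<rho>2 \<noteq> null_measure borel" "\<rho>02 \<noteq> null_measure borel"
    and eq: "\<And>a b. 0 \<le> a \<Longrightarrow> 0 \<le> b \<Longrightarrow>
      laplace_exp \<rho>01 (laplace_exp \<rho>1 a + laplace_exp \<rho>1 b) = laplace_exp \<rho>02 (laplace_exp \<rho>2 a + laplace_exp \<rho>2 b)"
  obtains c where "0 < c" "\<And>a. 0 \<le> a \<Longrightarrow> laplace_exp \<rho>2 a = c * laplace_exp \<rho>1 a"
proof -
  have eq1: "laplace_exp \<rho>01 (laplace_exp \<rho>1 a) = laplace_exp \<rho>02 (laplace_exp \<rho>2 a)" if "0 \<le> a" for a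
    using eq[OF that, of 0] by simp
  have inj: "x = y" if "laplace_exp \<rho>02 x = laplace_exp \<rho>02 y" "0 \<le> x" "0 \<le> y" for x y
  proof (rule ccontr)
    assume "x \<noteq> y"
    then consider "x < y" | "y < x" by linarith
    then show False
    proof cases
      case 1
      show False using laplace_exp_strict_mono[OF levy(3) nontriv(3) that(2) 1] that(1) by simp
    next
      case 2
      show False using laplace_exp_strict_mono[OF levy(3) nontriv(3) that(3) 2] that(1) by simp
    qed
  qed
  have ratio: "laplace_exp \<rho>1 b * laplace_exp \<rho>2 a = laplace_exp \<rho>1 a * laplace_exp \<rho>2 b" if "0 \<le> a" "a \<le> b" for a b
  proof (rule proportional_if_respects_sums[OF laplace_exp_continuous[OF levy(1)]])
    fix a b e :: real
    assume ab: "0 \<le> a" "0 \<le> b" "0 \<le> e" and "laplace_exp \<rho>1 a + laplace_exp \<rho>1 b = laplace_exp \<rho>1 e"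
    then have "laplace_exp \<rho>02 (laplace_exp \<rho>2 a + laplace_exp \<rho>2 b) = laplace_exp \<rho>02 (laplace_exp \<rho>2 e)"
      using eq[of a b] eq1[of e] by simp
    then show "laplace_exp \<rho>2 a + laplace_exp \<rho>2 b = laplace_exp \<rho>2 e"
      by (rule inj) (intro add_nonneg_nonneg laplace_exp_nonneg levy ab)+
  next
    show "laplace_exp \<rho>1 a < laplace_exp \<rho>1 b" if "0 \<le> a" "a < b" for a b
      using levy(1) nontriv(1) that by (rule laplace_exp_strict_mono)
    show "0 \<le> laplace_exp \<rho>2 a" if "0 \<le> a" for a
      using levy(2) that by (rule laplace_exp_nonneg)
  qed (use that in simp_all)
  have pos: "0 < laplace_exp \<rho>1 1" "0 < laplace_exp \<rho>2 1"
    using laplace_exp_strict_mono[of \<rho>1 0 1] laplace_exp_strict_mono[of \<rho>2 0 1] levy nontriv by auto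
  show thesis
  \<comment> \<open>The constant is read off at argument 1, where both exponents are
    positive.\<close>
  proof (rule that[of "laplace_exp \<rho>2 1 / laplace_exp \<rho>1 1"])
    show "laplace_exp \<rho>2 a = laplace_exp \<rho>2 1 / laplace_exp \<rho>1 1 * laplace_exp \<rho>1 a" if "0 \<le> a" for a
      \<comment> \<open>\<open>ratio\<close> needs ordered arguments, hence the case split.\<close>
      using ratio[of a 1] ratio[of 1 a] that pos by (cases "a \<le> 1") (auto simp: field_simps)
  qed (use pos in simp)
qed

lemma hCRV_eq_dist_iff:
  fixes \<mu>1 :: "'a \<Rightarrow> nat \<Rightarrow> ('x::polish_space) measure" and \<mu>2 :: "'b \<Rightarrow> nat \<Rightarrow> 'x measure"
  assumes d: "2 \<le> d"
    and levy: "levy_measure \<rho>1" "levy_measure \<rho>01" "levy_measure \<rho>2" "levy_measure \<rho>02"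
    and nontriv: "\<rho>1 \<noteq> null_measure borel" "\<rho>01 \<noteq> null_measure borel"
                 "\<rho>2 \<noteq> null_measure borel" "\<rho>02 \<noteq> null_measure borel"
    and P0: "prob_space P01" "sets P01 = sets borel" "prob_space P02" "sets P02 = sets borel"
    and h1: "is_hCRV M1 d \<mu>1 \<rho>1 \<rho>01 P01"
    and h2: "is_hCRV M2 d \<mu>2 \<rho>2 \<rho>02 P02"
  shows "eq_dist d M1 \<mu>1 M2 \<mu>2 \<longleftrightarrow>
    (\<exists>c>0. \<rho>02 = distr \<rho>01 borel (\<lambda>s. s / c) \<and> \<rho>2 = scale_measure (ennreal c) \<rho>1 \<and> P01 = P02)"
proof
  assume eq: "eq_dist d M1 \<mu>1 M2 \<mu>2"
  interpret P01: prob_space P01 by fact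
  interpret P02: prob_space P02 by fact
  \<comment> \<open>Only coordinates 1 and 2 get a nonzero rate; here \<open>2 \<le> d\<close>
    enters.\<close>
  have two_sum: "(\<Sum>i\<in>{1..d}. laplace_exp \<rho> (if i = 1 then a else if i = 2 then b else 0))
      = laplace_exp \<rho> a + laplace_exp \<rho> b" for \<rho> a b
  proof -
    have "(\<Sum>i\<in>{1..d}. laplace_exp \<rho> (if i = 1 then a else if i = 2 then b else 0))
      = (\<Sum>i\<in>{1, 2::nat}. laplace_exp \<rho> (if i = 1 then a else if i = 2 then b else 0))"
      using d by (intro sum.mono_neutral_right) auto
    then show ?thesis by simp
  qed
  have scaled: "measure P01 A * laplace_exp \<rho>01 (laplace_exp \<rho>1 a + laplace_exp \<rho>1 b)
      = measure P02 A * laplace_exp \<rho>02 (laplace_exp \<rho>2 a + laplace_exp \<rho>2 b)"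
    if "A \<in> sets borel" "0 \<le> a" "0 \<le> b" for A a b
    using hCRV_eq_distD[OF h1 h2 levy(1,3) eq that(1), of "\<lambda>i. if i = 1 then a else if i = 2 then b else 0"] that
    unfolding two_sum by simp
  have space: "space P01 = UNIV" "space P02 = UNIV"
    using sets_eq_imp_space_eq[OF P0(2)] sets_eq_imp_space_eq[OF P0(4)] by auto
  \<comment> \<open>On the whole space both base measures have mass 1 and drop out.\<close>
  have psi: "laplace_exp \<rho>01 (laplace_exp \<rho>1 a + laplace_exp \<rho>1 b) = laplace_exp \<rho>02 (laplace_exp \<rho>2 a + laplace_exp \<rho>2 b)"
    if "0 \<le> a" "0 \<le> b" for a b
    using scaled[of UNIV a b] that P01.prob_space P02.prob_space by (simp add: space)
  have psi1: "laplace_exp \<rho>01 (laplace_exp \<rho>1 a) = laplace_exp \<rho>02 (laplace_exp \<rho>2 a)" if "0 \<le> a" for a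
    using psi[OF that, of 0] by simp
  obtain c where c: "0 < c" "\<And>a. 0 \<le> a \<Longrightarrow> laplace_exp \<rho>2 a = c * laplace_exp \<rho>1 a"
    using laplace_exponents_proportional[OF levy(1,3,4) nontriv(1,3,4) psi] by blast
  have "0 < laplace_exp \<rho>1 1" using laplace_exp_strict_mono[OF levy(1) nontriv(1), of 0 1] by simp
  have "\<rho>2 = scale_measure (ennreal c) \<rho>1"
    using c by (intro laplace_exp_inject[where r=1] levy levy_measure_scale) (auto simp: levy_measure_scale levy)
  moreover have "\<rho>02 = distr \<rho>01 borel (\<lambda>s. s / c)"
  proof (rule laplace_exp_inject[where r="laplace_exp \<rho>2 1"])
    fix x assume x: "0 \<le> x" "x < laplace_exp \<rho>2 1"
    \<comment> \<open>The range of the inner exponent contains the interval from 0 to its value at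
      1, and agreement there suffices for \<open>laplace_exp_inject\<close>.\<close>
    obtain a where a: "0 \<le> a" "laplace_exp \<rho>2 a = x"
      using IVT'[of "laplace_exp \<rho>2" 0 x 1] x continuous_on_subset[OF laplace_exp_continuous[OF levy(3)], of "{0..1}"] by auto
    have "c * laplace_exp \<rho>1 a = x" using c(2)[OF a(1)] a(2) by simp
    then have "laplace_exp \<rho>1 a = x / c" using c(1) by (simp add: field_simps)
    then show "laplace_exp \<rho>02 x = laplace_exp (distr \<rho>01 borel (\<lambda>s. s / c)) x"
      using psi1[OF a(1)] a by (simp add: levy_measure_distr levy c)
  next
    show "0 < laplace_exp \<rho>2 1" using laplace_exp_strict_mono[OF levy(3) nontriv(3), of 0 1] by simp
  qed (use levy c in \<open>auto intro: levy_measure_distr\<close>)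
  moreover have "P01 = P02"
  proof (rule measure_eqI)
    fix A assume "A \<in> sets P01"
    then have "A \<in> sets borel" using P0 by simp
    \<comment> \<open>The composed exponent is positive at argument 1, so it can be cancelled from
      \<open>scaled\<close>.\<close>
    moreover have "0 < laplace_exp \<rho>01 (laplace_exp \<rho>1 1)"
      using laplace_exp_strict_mono[OF levy(2) nontriv(2), of 0 "laplace_exp \<rho>1 1"] \<open>0 < laplace_exp \<rho>1 1\<close> by simp
    ultimately have "measure P01 A = measure P02 A"
      using scaled[of A 1 0] psi1[of 1] by simp
    then show "emeasure P01 A = emeasure P02 A"
      by (simp add: P01.emeasure_eq_measure P02.emeasure_eq_measure)
  qed (simp add: P0)
  ultimately show "\<exists>c>0. \<rho>02 = distr \<rho>01 borel (\<lambda>s. s / c) \<and> \<rho>2 = scale_measure (ennreal c) \<rho>1 \<and> P01 = P02"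
    using c by blast
next
  assume "\<exists>c>0. \<rho>02 = distr \<rho>01 borel (\<lambda>s. s / c) \<and> \<rho>2 = scale_measure (ennreal c) \<rho>1 \<and> P01 = P02"
  then obtain c where c: "0 < c" and eqs: "\<rho>02 = distr \<rho>01 borel (\<lambda>s. s / c)"
    "\<rho>2 = scale_measure (ennreal c) \<rho>1" and P: "P02 = P01" by blast
  show "eq_dist d M1 \<mu>1 M2 \<mu>2"
  proof (rule hCRV_eq_distI[OF h1 h2[unfolded P] levy(1,3)])
    show "laplace_exp \<rho>01 (\<Sum>i\<in>{1..d}. laplace_exp \<rho>1 (lam i)) = laplace_exp \<rho>02 (\<Sum>i\<in>{1..d}. laplace_exp \<rho>2 (lam i))"
      for lam :: "nat \<Rightarrow> real"
      \<comment> \<open>Inner exponents are multiplied by \<open>c\<close> and the argument of the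
        outer one is divided by \<open>c\<close>, so the composition is unchanged.\<close>
      using c by (simp add: eqs levy_measure_scale levy_measure_distr levy sum_distrib_left[symmetric])
  qed
qed

theorem mainTheorem3:
  fixes d :: nat
    and M1 :: "'a measure" and \<mu>1 :: "'a \<Rightarrow> nat \<Rightarrow> ('x::polish_space) measure"
    and M2 :: "'b measure" and \<mu>2 :: "'b \<Rightarrow> nat \<Rightarrow> 'x measure"
    and \<rho>1 \<rho>01 \<rho>2 \<rho>02 :: "real measure" and P01 P02 :: "'x measure"
  assumes d: "2 \<le> d"
    and levy: "levy_measure \<rho>1" "levy_measure \<rho>01" "levy_measure \<rho>2" "levy_measure \<rho>02"
    and nontriv: "\<rho>1 \<noteq> null_measure borel" "\<rho>01 \<noteq> null_measure borel"
                 "\<rho>2 \<noteq> null_measure borel" "\<rho>02 \<noteq> null_measure borel"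
    and P0: "atomless_prob P01" "atomless_prob P02"
    and h1: "is_hCRV M1 d \<mu>1 \<rho>1 \<rho>01 P01"
    and h2: "is_hCRV M2 d \<mu>2 \<rho>2 \<rho>02 P02"
  shows "(eq_dist d M1 \<mu>1 M2 \<mu>2 \<longleftrightarrow>
            (\<exists>c>0. \<rho>02 = distr \<rho>01 borel (\<lambda>s. s / c) \<and>
                   \<rho>2 = scale_measure (ennreal c) \<rho>1 \<and> P01 = P02))
       \<and> (\<forall>f1 f01 f2 f02 :: real \<Rightarrow> real.
            (\<forall>f\<in>{f1, f01, f2, f02}. f \<in> borel_measurable borel \<and> (\<forall>s. 0 \<le> f s)) \<and>
            \<rho>1 = density lborel (\<lambda>s. ennreal (f1 s)) \<and> \<rho>01 = density lborel (\<lambda>s. ennreal (f01 s)) \<and>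
            \<rho>2 = density lborel (\<lambda>s. ennreal (f2 s)) \<and> \<rho>02 = density lborel (\<lambda>s. ennreal (f02 s))
          \<longrightarrow> (eq_dist d M1 \<mu>1 M2 \<mu>2 \<longleftrightarrow>
               (\<exists>c>0. (AE s in lborel. 0 < s \<longrightarrow> f02 s = c * f01 (c * s) \<and> f2 s = c * f1 s)
                      \<and> P01 = P02)))"
proof -
  have iff: "eq_dist d M1 \<mu>1 M2 \<mu>2 \<longleftrightarrow>
      (\<exists>c>0. \<rho>02 = distr \<rho>01 borel (\<lambda>s. s / c) \<and> \<rho>2 = scale_measure (ennreal c) \<rho>1 \<and> P01 = P02)"
    using P0 by (intro hCRV_eq_dist_iff[OF d levy nontriv _ _ _ _ h1 h2]) (auto simp: atomless_prob_def)
  \<comment> \<open>The condition on measures is translated for each fixed \<open>c\<close>, so that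
    the existential over \<open>c\<close> carries over.\<close>
  have density_iff: "(\<rho>02 = distr \<rho>01 borel (\<lambda>s. s / c) \<and> \<rho>2 = scale_measure (ennreal c) \<rho>1) \<longleftrightarrow>
      (AE s in lborel. 0 < s \<longrightarrow> f02 s = c * f01 (c * s) \<and> f2 s = c * f1 s)"
    if f: "\<forall>f\<in>{f1, f01, f2, f02}. f \<in> borel_measurable borel \<and> (\<forall>s. 0 \<le> f s)"
      and \<rho>: "\<rho>1 = density lborel (\<lambda>s. ennreal (f1 s))" "\<rho>01 = density lborel (\<lambda>s. ennreal (f01 s))"
        "\<rho>2 = density lborel (\<lambda>s. ennreal (f2 s))" "\<rho>02 = density lborel (\<lambda>s. ennreal (f02 s))"
      and c: "0 < c" for f1 f01 f2 f02 :: "real \<Rightarrow> real" and c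
  proof -
    have [measurable]: "f1 \<in> borel_measurable borel" "f01 \<in> borel_measurable borel"
      "f2 \<in> borel_measurable borel" "f02 \<in> borel_measurable borel" using f by auto
    have nonneg: "0 \<le> f1 s" "0 \<le> f01 s" "0 \<le> f2 s" "0 \<le> f02 s" for s using f by auto
    have distr: "distr \<rho>01 borel (\<lambda>s. s / c) = density lborel (\<lambda>s. ennreal (c * f01 (c * s)))"
      unfolding \<rho> using c by (rule distr_density_lborel_divide[rotated]) measurable
    have scale: "scale_measure (ennreal c) \<rho>1 = density lborel (\<lambda>s. ennreal (c * f1 s))"
      unfolding \<rho> using c by (rule scale_density_lborel[rotated]) measurable
    \<comment> \<open>The image and the scaled measure are again Levy measures, so
      \<open>levy_density_eq_iff\<close> applies to their densities.\<close>
    have "\<rho>02 = distr \<rho>01 borel (\<lambda>s. s / c) \<longleftrightarrow> (AE s in lborel. 0 < s \<longrightarrow> f02 s = c * f01 (c * s))"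
      using levy_measure_distr(1)[OF levy(2) c] levy(4) c nonneg unfolding distr unfolding \<rho>(4)
      by (intro levy_density_eq_iff) auto
    moreover have "\<rho>2 = scale_measure (ennreal c) \<rho>1 \<longleftrightarrow> (AE s in lborel. 0 < s \<longrightarrow> f2 s = c * f1 s)"
      using levy_measure_scale(1)[OF levy(1) c] levy(3) c nonneg unfolding scale unfolding \<rho>(3)
      by (intro levy_density_eq_iff) auto
    moreover have "(AE s in lborel. 0 < s \<longrightarrow> f02 s = c * f01 (c * s) \<and> f2 s = c * f1 s) \<longleftrightarrow>
        (AE s in lborel. 0 < s \<longrightarrow> f02 s = c * f01 (c * s)) \<and> (AE s in lborel. 0 < s \<longrightarrow> f2 s = c * f1 s)"
      unfolding eventually_conj_iff[symmetric] by (rule arg_cong[where f="\<lambda>P. eventually P _"]) auto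
    ultimately show ?thesis by blast
  qed
  show ?thesis
  proof (intro conjI iff allI impI, elim conjE)
    fix f1 f01 f2 f02 :: "real \<Rightarrow> real"
    assume "\<forall>f\<in>{f1, f01, f2, f02}. f \<in> borel_measurable borel \<and> (\<forall>s. 0 \<le> f s)"
      "\<rho>1 = density lborel (\<lambda>s. ennreal (f1 s))" "\<rho>01 = density lborel (\<lambda>s. ennreal (f01 s))"
      "\<rho>2 = density lborel (\<lambda>s. ennreal (f2 s))" "\<rho>02 = density lborel (\<lambda>s. ennreal (f02 s))"
    note this_iff = density_iff[OF this]
    show "eq_dist d M1 \<mu>1 M2 \<mu>2 \<longleftrightarrow>
      (\<exists>c>0. (AE s in lborel. 0 < s \<longrightarrow> f02 s = c * f01 (c * s) \<and> f2 s = c * f1 s) \<and> P01 = P02)"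
      unfolding iff using this_iff by (intro ex_cong1) auto
  qed
qed

end
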